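(* Let $1\le p\le2$ and let $\mu\in\mathcal{M}_p$ be a finite Borel measure on $\mathbb{R}^n$. Then $\widehat\mu\in L^{p'}(\mathbb{R}^n)$ and $$\|\widehat\mu\|_{p'}\le\|\mu\|_p^*.$$
   Context: For functions, $\widehat f(y)=\int_{\mathbb{R}^n} f(x)e^{-2\pi i x\cdot y}\,dx$ (extended to $L^p(\mathbb{R}^n)$, in the distributional sense when necessary). $p'$ denotes the conjugate exponent, $\frac1p+\frac1{p'}=1$, and $\|\cdot\|_p$ the norm of $L^p(\mathbb{R}^n,dx)$. For $p\in[1,\infty]$, $\widehat L^p(\mathbb{R}^n)=\{f\in L^p(\mathbb{R}^n): f=\widehat g \text{ for some } g\in L^{p'}(\mathbb{R}^n)\}$ with norm $\|f\|_{\widehat L^p}=\|\widehat f\|_{p'}$. $\mathcal{M}$ is the space of sigma-finite Borel measures on $\mathbb{R}^n$ (not assumed positive or real-valued). For $\mu\in\mathcal{M}$, $\|\mu\|_p^*=\sup\left\{\left|\int_{\mathbb{R}^n}h\,d\mu\right| : h\in\widehat L^{p'}(\mathbb{R}^n),\ \|h\|_{\widehat L^{p'}}\le 1\right\}$, and $\mathcal{M}_p=\{\mu\in\mathcal{M}:\|\mu\|_p^*<\infty\}$. The Fourier transform of a finite Borel measure is the function $\widehat\mu(y)=\int_{\mathbb{R}^n}e^{-2\pi i x\cdot y}\,d\mu(x)$. *)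

theory Defs
  imports "HOL-Probability.Essential_Supremum"
begin

text \<open>Exponents \<open>p \<in> [1, \<infinity>]\<close> have type \<^typ>\<open>ennreal\<close>, where \<open>inverse 0 = \<infinity>\<close> and
  \<open>inverse \<infinity> = 0\<close>. Elements of \<open>L\<^sup>p\<close> are Borel functions; almost everywhere equal functions are
  not identified.\<close>

definition conj_exponent :: "ennreal \<Rightarrow> ennreal" where
  "conj_exponent p = inverse (1 - inverse p)"

definition Lp_norm :: "ennreal \<Rightarrow> ('a::euclidean_space \<Rightarrow> complex) \<Rightarrow> ennreal" where
  "Lp_norm p f =
    (if p = \<infinity> then esssup lborel (\<lambda>x. ennreal (norm (f x)))
     else let I = (\<integral>\<^sup>+ x. ennreal (norm (f x) powr enn2real p) \<partial>lborel)
          in if I = \<infinity> then \<infinity> else ennreal (enn2real I powr (1 / enn2real p)))"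

definition Lp :: "ennreal \<Rightarrow> ('a::euclidean_space \<Rightarrow> complex) set" where
  "Lp p = {f \<in> borel_measurable borel. Lp_norm p f < \<infinity>}"


primrec iterated_partial ::
  "'a::euclidean_space list \<Rightarrow> ('a \<Rightarrow> complex) \<Rightarrow> 'a \<Rightarrow> complex" where
  "iterated_partial [] f = f"
| "iterated_partial (b # bs) f =
    (\<lambda>x. frechet_derivative (iterated_partial bs f) (at x) b)"

definition schwartz :: "('a::euclidean_space \<Rightarrow> complex) \<Rightarrow> bool" where
  "schwartz f \<longleftrightarrow> (\<forall>bs. set bs \<subseteq> Basis \<longrightarrow>
     (\<forall>x. iterated_partial bs f differentiable (at x)) \<and>
     (\<forall>k::nat. bounded (range (\<lambda>x. norm x ^ k *\<^sub>R iterated_partial bs f x))))"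

definition fourier_integral :: "('a::euclidean_space \<Rightarrow> complex) \<Rightarrow> 'a \<Rightarrow> complex" where
  "fourier_integral f y =
    (\<integral>x. exp (- 2 * complex_of_real pi * \<i> * complex_of_real (x \<bullet> y)) * f x \<partial>lborel)"

text \<open>\<open>is_fourier f g\<close>: \<open>f\<close> and \<open>g\<close> define tempered distributions, and that of \<open>g\<close> is the
  Fourier transform of that of \<open>f\<close>.\<close>

definition is_fourier ::
  "('a::euclidean_space \<Rightarrow> complex) \<Rightarrow> ('a \<Rightarrow> complex) \<Rightarrow> bool" where
  "is_fourier f g \<longleftrightarrow>
     f \<in> borel_measurable borel \<and> g \<in> borel_measurable borel \<and>
     (\<forall>\<phi>. schwartz \<phi> \<longrightarrow>
        integrable lborel (\<lambda>x. f x * fourier_integral \<phi> x) \<and>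
        integrable lborel (\<lambda>y. g y * \<phi> y) \<and>
        (\<integral>y. g y * \<phi> y \<partial>lborel) = (\<integral>x. f x * fourier_integral \<phi> x \<partial>lborel))"

text \<open>The transform is determined up to a Lebesgue null set, which \<^const>\<open>Lp_norm\<close> ignores.\<close>

definition fourier :: "('a::euclidean_space \<Rightarrow> complex) \<Rightarrow> 'a \<Rightarrow> complex" where
  "fourier f = (SOME g. is_fourier f g)"

definition hat_Lp :: "ennreal \<Rightarrow> ('a::euclidean_space \<Rightarrow> complex) set" where
  "hat_Lp p = {f \<in> Lp p. \<exists>g \<in> Lp (conj_exponent p). is_fourier g f}"

definition hat_Lp_norm :: "ennreal \<Rightarrow> ('a::euclidean_space \<Rightarrow> complex) \<Rightarrow> ennreal" where
  "hat_Lp_norm p f = Lp_norm (conj_exponent p) (fourier f)"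


text \<open>A finite Borel measure, not assumed positive or real-valued, is a countably additive
  complex set function on the Borel sets (it then has finite total variation). Values off the
  Borel sets are irrelevant.\<close>

definition finite_complex_measure :: "('a::topological_space set \<Rightarrow> complex) \<Rightarrow> bool" where
  "finite_complex_measure \<mu> \<longleftrightarrow>
     \<mu> {} = 0 \<and>
     (\<forall>A :: nat \<Rightarrow> 'a set. range A \<subseteq> sets borel \<longrightarrow> disjoint_family A \<longrightarrow>
        (\<lambda>i. \<mu> (A i)) sums \<mu> (\<Union>i. A i))"

text \<open>The positive part of the Jordan decomposition of a finite signed measure; sets of negative
  measure contribute 0 to the supremum.\<close>

definition positive_variation :: "('a::topological_space set \<Rightarrow> real) \<Rightarrow> 'a measure" where
  "positive_variation \<nu> =
     measure_of UNIV (sets borel) (\<lambda>A. SUP B\<in>{B \<in> sets borel. B \<subseteq> A}. ennreal (\<nu> B))"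

definition Re_pos :: "('a::topological_space set \<Rightarrow> complex) \<Rightarrow> 'a measure" where
  "Re_pos \<mu> = positive_variation (\<lambda>A. Re (\<mu> A))"

definition Re_neg :: "('a::topological_space set \<Rightarrow> complex) \<Rightarrow> 'a measure" where
  "Re_neg \<mu> = positive_variation (\<lambda>A. - Re (\<mu> A))"

definition Im_pos :: "('a::topological_space set \<Rightarrow> complex) \<Rightarrow> 'a measure" where
  "Im_pos \<mu> = positive_variation (\<lambda>A. Im (\<mu> A))"

definition Im_neg :: "('a::topological_space set \<Rightarrow> complex) \<Rightarrow> 'a measure" where
  "Im_neg \<mu> = positive_variation (\<lambda>A. - Im (\<mu> A))"

definition cm_integrable ::
  "('a::topological_space set \<Rightarrow> complex) \<Rightarrow> ('a \<Rightarrow> complex) \<Rightarrow> bool" where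
  "cm_integrable \<mu> h \<longleftrightarrow>
     (\<forall>M \<in> {Re_pos \<mu>, Re_neg \<mu>, Im_pos \<mu>, Im_neg \<mu>}. integrable M h)"

definition cm_integral ::
  "('a::topological_space set \<Rightarrow> complex) \<Rightarrow> ('a \<Rightarrow> complex) \<Rightarrow> complex" where
  "cm_integral \<mu> h =
     (\<integral>x. h x \<partial>Re_pos \<mu>) - (\<integral>x. h x \<partial>Re_neg \<mu>)
     + \<i> * ((\<integral>x. h x \<partial>Im_pos \<mu>) - (\<integral>x. h x \<partial>Im_neg \<mu>))"

definition fourier_measure ::
  "('a::euclidean_space set \<Rightarrow> complex) \<Rightarrow> 'a \<Rightarrow> complex" where
  "fourier_measure \<mu> y =
     cm_integral \<mu> (\<lambda>x. exp (- 2 * complex_of_real pi * \<i> * complex_of_real (x \<bullet> y)))"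


text \<open>A class in \<open>hat_Lp\<close> is a function modulo Lebesgue null sets, which a singular \<open>\<mu>\<close> may
  charge, so \<open>\<integral>h d\<mu>\<close> depends on the representative. If every representative were allowed, the norm
  below would be infinite for each \<open>\<mu>\<close> that is not absolutely continuous, even for a point mass and
  \<open>p = 1\<close>. The representative is therefore required to be the limit of its averages at
  \<open>|\<mu>|\<close>-almost every point. This is automatic if \<open>\<mu>\<close> is absolutely continuous (Lebesgue
  differentiation) or if \<open>h\<close> is continuous.\<close>

definition averages_converge :: "('a::euclidean_space \<Rightarrow> complex) \<Rightarrow> 'a \<Rightarrow> bool" where
  "averages_converge h x \<longleftrightarrow>
     ((\<lambda>r. (LINT z:ball x r|lborel. h z) /\<^sub>R measure lborel (ball x r)) \<longlongrightarrow> h x) (at_right 0)"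

definition precise_for ::
  "('a::euclidean_space set \<Rightarrow> complex) \<Rightarrow> ('a \<Rightarrow> complex) \<Rightarrow> bool" where
  "precise_for \<mu> h \<longleftrightarrow>
     (\<forall>M \<in> {Re_pos \<mu>, Re_neg \<mu>, Im_pos \<mu>, Im_neg \<mu>}. AE x in M. averages_converge h x)"

definition star_norm :: "ennreal \<Rightarrow> ('a::euclidean_space set \<Rightarrow> complex) \<Rightarrow> ennreal" where
  "star_norm p \<mu> =
     (SUP h \<in> {h \<in> hat_Lp (conj_exponent p). hat_Lp_norm (conj_exponent p) h \<le> 1
                \<and> precise_for \<mu> h \<and> cm_integrable \<mu> h}.
        ennreal (norm (cm_integral \<mu> h)))"

end

theory Submission
  imports Defs "HOL-Probability.Probability"
begin

text \<open>Write \<open>F u\<close> for the Fourier transform. By duality it suffices to bound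
  \<open>\<integral> u F\<mu> dx = \<integral> F u d\<mu>\<close> for \<open>u \<in> L\<^sup>1 \<inter> L\<^sup>p\<close> of norm at most 1 in \<open>L\<^sup>p\<close>. The function \<open>F u\<close>
  need not be an admissible test function for \<open>star_norm\<close>, but its product with the Gaussian
  \<open>gauss_hat s\<close> is: it is continuous, bounded and integrable, and it is the transform of the
  convolution \<open>\<phi>\<close> of \<open>u\<close> with \<open>gauss_kernel s\<close>, whose norm in \<open>L\<^sup>p\<close> is at most 1 by Jensen's
  inequality. Fourier inversion for \<open>\<phi>\<close> is Fubini together with the explicit transform of a
  Gaussian. Since \<open>fourier\<close> is a choice, uniqueness of the distributional transform is needed as
  well; it is obtained by testing against Gaussians. Finally let \<open>s\<close> tend to 0.\<close>

section \<open>Finiteness of the variations\<close>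

text \<open>What is at hand about \<open>F u\<close> is that it is bounded and continuous; that it
  lies in the conjugate L^q, as \<open>hat_Lp\<close> demands, would take the Hausdorff-Young
  inequality. The Gaussian factor makes the product bounded and integrable, hence a member of every
  L^q, and on the other side of the transform it is convolution with a probability density, so the
  bound obtained is the same for all \<open>s\<close>. Continuity also settles the choice of
  representative: averages of the product converge at every point, whatever null sets \<mu> charges.
  Gaussians carry the uniqueness proof too, because the product of two of them is a multiple of a
  third. The transform of \<mu> is bounded a priori by total masses, with a constant unrelated to
  the dual norm; this makes truncations to balls integrable before anything is known about its L^q
  norm. The endpoint p = 1, where the conjugate exponent is infinite, has its own extremal functions
  in the duality argument.\<close>

lemma finite_complex_measure_Un:
  assumes "finite_complex_measure \<mu>" "A \<in> sets borel" "B \<in> sets borel" "A \<inter> B = {}"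
  shows "\<mu> (A \<union> B) = \<mu> A + \<mu> B"
proof -
  have "disjoint_family (binaryset A B)"
    using assms(4) by (auto simp: disjoint_family_on_def binaryset_def)
  moreover have "range (binaryset A B) \<subseteq> sets borel"
    using assms(2,3) by (auto simp: range_binaryset_eq)
  ultimately have "(\<lambda>i. \<mu> (binaryset A B i)) sums \<mu> (\<Union>i. binaryset A B i)"
    using assms(1) unfolding finite_complex_measure_def by blast
  moreover have "(\<lambda>i. \<mu> (binaryset A B i)) sums (\<mu> A + \<mu> B)"
    using assms(1) by (intro binaryset_sums) (simp add: finite_complex_measure_def)
  ultimately show ?thesis
    by (metis UN_binaryset_eq sums_unique2)
qed

text \<open>If \<open>\<mu>\<close> were unbounded, one could repeatedly split off a set of measure at least 1 from a set
  with unbounded restriction; the pieces are disjoint and their measures do not tend to 0.\<close>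

lemma finite_complex_measure_bounded:
  fixes \<mu> :: "'a::topological_space set \<Rightarrow> complex"
  assumes "finite_complex_measure \<mu>"
  obtains K where "\<And>B. B \<in> sets borel \<Longrightarrow> norm (\<mu> B) \<le> K"
proof -
  define bad where "bad A \<longleftrightarrow> A \<in> sets borel \<and> (\<forall>K. \<exists>B\<in>sets borel. B \<subseteq> A \<and> norm (\<mu> B) > K)"
    for A
  have split: "\<exists>B. bad B \<and> B \<subseteq> A \<and> norm (\<mu> (A - B)) \<ge> 1" if A: "bad A" for A
  proof -
    \<comment> \<open>The surplus over \<open>norm (\<mu> A)\<close> forces
      \<open>norm (\<mu> (A - B)) \<ge> 1\<close> as well, so whichever of the two halves stays bad,
      the discarded one is large.\<close>
    obtain B where B: "B \<in> sets borel" "B \<subseteq> A" "norm (\<mu> B) > norm (\<mu> A) + 1"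
      using A unfolding bad_def by blast
    have A': "A \<in> sets borel" using A by (simp add: bad_def)
    have AB: "A - B \<in> sets borel" using A' B by auto
    have "\<mu> A = \<mu> B + \<mu> (A - B)"
      using finite_complex_measure_Un[OF assms B(1) AB] B(2) by (simp add: Un_absorb1)
    then have "norm (\<mu> B) \<le> norm (\<mu> A) + norm (\<mu> (A - B))"
      by (metis add_diff_cancel_right' norm_triangle_ineq4)
    then have 1: "norm (\<mu> (A - B)) \<ge> 1" using B by simp
    have "bad B \<or> bad (A - B)"
    proof (rule ccontr)
      assume "\<not> ?thesis"
      then obtain K1 K2 where K: "\<And>C. C \<in> sets borel \<Longrightarrow> C \<subseteq> B \<Longrightarrow> norm (\<mu> C) \<le> K1"
        "\<And>C. C \<in> sets borel \<Longrightarrow> C \<subseteq> A - B \<Longrightarrow> norm (\<mu> C) \<le> K2"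
        using B AB unfolding bad_def by (metis not_less)
      obtain C where C: "C \<in> sets borel" "C \<subseteq> A" "norm (\<mu> C) > K1 + K2"
        using A unfolding bad_def by blast
      have "C = (C \<inter> B) \<union> (C - B)" by auto
      then have "\<mu> C = \<mu> (C \<inter> B) + \<mu> (C - B)"
        using finite_complex_measure_Un[OF assms, of "C \<inter> B" "C - B"] C(1) B(1)
        by (metis Diff_disjoint Int_assoc Int_Diff inf_bot_right sets.Diff sets.Int)
      then have "norm (\<mu> C) \<le> norm (\<mu> (C \<inter> B)) + norm (\<mu> (C - B))"
        by (simp add: norm_triangle_ineq)
      also have "\<dots> \<le> K1 + K2"
        using C(1,2) B(1) by (intro add_mono K) auto
      finally show False using C by simp
    qed
    then show ?thesis
    proof
      assume "bad B" then show ?thesis using B 1 by auto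
    next
      assume "bad (A - B)"
      moreover have "A - (A - B) = B" using B by auto
      moreover have "norm (\<mu> B) \<ge> 1" using B(3) norm_ge_zero[of "\<mu> A"] by linarith
      ultimately show ?thesis by (intro exI[of _ "A - B"]) simp
    qed
  qed
  have "\<not> bad UNIV"
  proof
    assume "bad UNIV"
    then have "\<exists>A. \<forall>n. bad (A n) \<and> (A (Suc n) \<subseteq> A n \<and> norm (\<mu> (A n - A (Suc n))) \<ge> 1)"
      using split by (intro dependent_nat_choice) auto
    then obtain A where A: "\<And>n. bad (A n)" "\<And>n. A (Suc n) \<subseteq> A n" "\<And>n. norm (\<mu> (A n - A (Suc n))) \<ge> 1"
      by blast
    have dec: "decseq A" using A(2) by (simp add: decseq_Suc_iff)
    have "disjoint_family (\<lambda>n. A n - A (Suc n))"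
      unfolding disjoint_family_on_def
    proof safe
      fix m n :: nat assume "m \<noteq> n"
      then have "A n \<subseteq> A (Suc m) \<or> A m \<subseteq> A (Suc n)"
        using decseqD[OF dec, of "Suc m" n] decseqD[OF dec, of "Suc n" m] by (meson Suc_leI nat_neq_iff)
      moreover fix x assume "x \<in> A m" "x \<notin> A (Suc m)" "x \<in> A n" "x \<notin> A (Suc n)"
      ultimately show "x \<in> {}" by auto
    qed
    moreover have "range (\<lambda>n. A n - A (Suc n)) \<subseteq> sets borel"
      using A(1) unfolding bad_def by auto
    ultimately have "(\<lambda>n. \<mu> (A n - A (Suc n))) sums \<mu> (\<Union>n. A n - A (Suc n))"
      using assms unfolding finite_complex_measure_def by blast
    then have "(\<lambda>n. \<mu> (A n - A (Suc n))) \<longlonglongrightarrow> 0"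
      using sums_summable summable_LIMSEQ_zero by blast
    then have "eventually (\<lambda>n. norm (\<mu> (A n - A (Suc n))) < 1) sequentially"
      by (metis (mono_tags) order_tendsto_iff tendsto_norm_zero_iff zero_less_one)
    then show False using A(3) by (auto simp: eventually_sequentially not_less[symmetric])
  qed
  then obtain K where "\<And>B. B \<in> sets borel \<Longrightarrow> norm (\<mu> B) \<le> K"
    unfolding bad_def by (auto simp: not_less)
  then show ?thesis by (rule that)
qed

lemma sets_positive_variation [simp, measurable_cong]:
  "sets (positive_variation (\<nu> :: 'a::topological_space set \<Rightarrow> real)) = sets borel"
  using sets.sigma_sets_eq[of "borel :: 'a measure"] by (simp add: positive_variation_def sets_measure_of)

lemma space_positive_variation [simp]: "space (positive_variation \<nu>) = UNIV"
  by (simp add: positive_variation_def space_measure_of_conv)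

text \<open>Additivity of the supremum defining \<open>positive_variation\<close> is irrelevant here: without it
  \<open>measure_of\<close> yields the null measure.\<close>

lemma finite_measure_positive_variation:
  assumes "\<And>B. B \<in> sets borel \<Longrightarrow> \<nu> B \<le> K"
  shows "finite_measure (positive_variation \<nu>)"
proof (rule finite_measureI)
  let ?f = "\<lambda>A. SUP B\<in>{B \<in> sets borel. B \<subseteq> A}. ennreal (\<nu> B)"
  have "emeasure (positive_variation \<nu>) UNIV \<le> ?f UNIV"
    unfolding positive_variation_def emeasure_measure_of_conv by simp
  also have "?f UNIV \<le> ennreal K"
    using assms by (intro SUP_least) (auto intro: ennreal_leI)
  finally show "emeasure (positive_variation \<nu>) (space (positive_variation \<nu>)) \<noteq> \<infinity>"
    by (auto simp: top_unique)
qed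

text \<open>Integrals against \<mu> are combinations of integrals against these four measures;
  finiteness and the common sigma-algebra open each of them to dominated convergence and Fubini.
  Quantifying over the four-element set treats them all at once.\<close>

lemma finite_measure_variations:
  assumes "finite_complex_measure \<mu>" "M \<in> {Re_pos \<mu>, Re_neg \<mu>, Im_pos \<mu>, Im_neg \<mu>}"
  shows "finite_measure M" "sets M = sets borel"
proof -
  obtain K where K: "\<And>B. B \<in> sets borel \<Longrightarrow> norm (\<mu> B) \<le> K"
    using finite_complex_measure_bounded[OF assms(1)] by blast
  have "Re (\<mu> B) \<le> K" "- Re (\<mu> B) \<le> K" "Im (\<mu> B) \<le> K" "- Im (\<mu> B) \<le> K" if "B \<in> sets borel" for B
    using K[OF that] abs_Re_le_cmod[of "\<mu> B"] abs_Im_le_cmod[of "\<mu> B"] by linarith+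
  then show "finite_measure M"
    using assms(2) by (auto simp: Re_pos_def Re_neg_def Im_pos_def Im_neg_def
        intro!: finite_measure_positive_variation)
  show "sets M = sets borel"
    using assms(2) by (auto simp: Re_pos_def Re_neg_def Im_pos_def Im_neg_def)
qed

section \<open>Characters and Gaussians\<close>

definition fourier_character :: "'a::euclidean_space \<Rightarrow> 'a \<Rightarrow> complex" where
  "fourier_character x y = exp (- 2 * complex_of_real pi * \<i> * complex_of_real (x \<bullet> y))"

lemma norm_fourier_character [simp]: "norm (fourier_character x y) = 1"
  by (simp add: fourier_character_def)

lemma fourier_character_commute: "fourier_character x y = fourier_character y x"
  by (simp add: fourier_character_def inner_commute)

lemma fourier_character_add_left:
  "fourier_character (x + z) y = fourier_character x y * fourier_character z y"
  by (simp add: fourier_character_def inner_add_left distrib_left exp_add[symmetric])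

lemma measurable_fourier_character [measurable (raw)]:
  assumes [measurable]: "f \<in> borel_measurable M" "g \<in> borel_measurable M"
  shows "(\<lambda>x. fourier_character (f x) (g x)) \<in> borel_measurable M"
  unfolding fourier_character_def by measurable

lemma fourier_integral_altdef:
  "fourier_integral f y = (\<integral>x. fourier_character x y * f x \<partial>lborel)"
  by (simp add: fourier_integral_def fourier_character_def)

lemma integrable_fourier_character_mult:
  assumes "integrable M f" and [measurable]: "h \<in> borel_measurable M"
  shows "integrable M (\<lambda>x. fourier_character (h x) y * f x)"
proof -
  have [measurable]: "f \<in> borel_measurable M" using assms(1) by simp
  show ?thesis
    by (rule Bochner_Integration.integrable_bound[OF assms(1)]) (auto simp: norm_mult)
qed

lemma norm_integral_fourier_character_le:
  fixes f :: "'b \<Rightarrow> complex"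
  shows "norm (\<integral>x. fourier_character (h x) y * f x \<partial>M) \<le> (\<integral>x. norm (f x) \<partial>M)"
  by (rule order_trans[OF integral_norm_bound]) (simp add: norm_mult)

text \<open>The kernel has modulus 1, so integrability of \<open>f\<close> and \<open>g\<close>
  makes the double integral absolutely convergent. It serves with Lebesgue measure on both sides for
  the multiplication formula and for inversion, and with a variation of \<mu> on one side in
  \<open>integral_mult_fourier_measure\<close>; hence the general measures.\<close>

lemma fourier_fubini:
  fixes f g :: "'a::euclidean_space \<Rightarrow> complex"
  assumes "sigma_finite_measure M" "sigma_finite_measure N"
    and [measurable_cong]: "sets M = sets borel" "sets N = sets borel"
    and f: "integrable M f" and g: "integrable N g"
  shows "(\<integral>y. g y * (\<integral>x. fourier_character x y * f x \<partial>M) \<partial>N)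
       = (\<integral>x. f x * (\<integral>y. fourier_character x y * g y \<partial>N) \<partial>M)"
proof -
  interpret pair_sigma_finite M N
    using assms(1,2) by (simp add: pair_sigma_finite_def)
  have [measurable]: "f \<in> borel_measurable borel" "g \<in> borel_measurable borel"
    using borel_measurable_integrable[OF f] borel_measurable_integrable[OF g]
    by (simp_all cong: measurable_cong_sets)
  have "integrable (M \<Otimes>\<^sub>M N) (\<lambda>(x, y). fourier_character x y * (f x * g y))"
  proof (rule Fubini_integrable)
    show "integrable M (\<lambda>x. \<integral>y. norm (case (x, y) of (x, y) \<Rightarrow> fourier_character x y * (f x * g y)) \<partial>N)"
      using f g by (simp add: norm_mult)
    have "integrable N (\<lambda>y. fourier_character y x * (f x * g y))" for x
      using g by (intro integrable_fourier_character_mult integrable_mult_right) auto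
    then show "AE x in M. integrable N (\<lambda>y. case (x, y) of (x, y) \<Rightarrow> fourier_character x y * (f x * g y))"
      by (simp add: fourier_character_commute)
  qed measurable
  from Fubini_integral[OF this]
  have "(\<integral>y. (\<integral>x. g y * (fourier_character x y * f x) \<partial>M) \<partial>N)
     = (\<integral>x. (\<integral>y. f x * (fourier_character x y * g y) \<partial>N) \<partial>M)"
    by (simp add: mult_ac)
  then show ?thesis by simp
qed

lemma continuous_on_integral_fourier_character:
  fixes f :: "'a::euclidean_space \<Rightarrow> complex"
  assumes "sets M = sets borel" "integrable M f"
  shows "continuous_on UNIV (\<lambda>y. \<integral>x. fourier_character x y * f x \<partial>M)"
proof (rule continuous_on_sequentiallyI)
  note [measurable_cong] = assms(1)
  have [measurable]: "f \<in> borel_measurable borel"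
    using borel_measurable_integrable[OF assms(2)] assms(1) by (simp cong: measurable_cong_sets)
  fix u :: "nat \<Rightarrow> 'a" and a assume u: "u \<longlonglongrightarrow> a"
  show "(\<lambda>n. \<integral>x. fourier_character x (u n) * f x \<partial>M) \<longlonglongrightarrow> (\<integral>x. fourier_character x a * f x \<partial>M)"
  proof (rule integral_dominated_convergence[where w = "\<lambda>x. norm (f x)"])
    show "AE x in M. (\<lambda>n. fourier_character x (u n) * f x) \<longlonglongrightarrow> fourier_character x a * f x"
      unfolding fourier_character_def by (intro AE_I2 tendsto_intros u)
  qed (use assms in \<open>auto simp: norm_mult\<close>)
qed

section \<open>Lebesgue measure: reflections, translations, products over coordinates\<close>

lemma lborel_distr_reflect:
  fixes t :: "'a::euclidean_space"
  shows "distr lborel borel (\<lambda>x. t - x) = lborel"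
  using lborel_affine[of "-1" t, symmetric] by (simp add: density_1)

lemma lborel_distr_translate:
  fixes t :: "'a::euclidean_space"
  shows "distr lborel borel (\<lambda>x. x + t) = lborel"
  using lborel_distr_plus[of t] by (simp add: add.commute[of t] cong: distr_cong)

lemma lborel_integrable_reflect:
  fixes f :: "'a::euclidean_space \<Rightarrow> 'b::{banach, second_countable_topology}"
  assumes "integrable lborel f"
  shows "integrable lborel (\<lambda>x. f (t - x))"
proof -
  have "integrable (distr lborel borel (\<lambda>x. t - x)) f" using assms by (simp add: lborel_distr_reflect)
  then show ?thesis by (subst (asm) integrable_distr_eq) (use assms in auto)
qed

lemma lborel_integral_translate:
  fixes f :: "'a::euclidean_space \<Rightarrow> 'b::{banach, second_countable_topology}"
  assumes [measurable]: "f \<in> borel_measurable borel"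
  shows "(\<integral>x. f (x + t) \<partial>lborel) = (\<integral>x. f x \<partial>lborel)"
  by (subst (2) lborel_distr_translate[of t, symmetric]) (simp add: integral_distr)

lemma lborel_nn_integral_reflect:
  fixes f :: "'a::euclidean_space \<Rightarrow> ennreal"
  assumes [measurable]: "f \<in> borel_measurable borel"
  shows "(\<integral>\<^sup>+x. f (t - x) \<partial>lborel) = (\<integral>\<^sup>+x. f x \<partial>lborel)"
  by (subst (2) lborel_distr_reflect[of t, symmetric]) (simp add: nn_integral_distr)

lemma lborel_nn_integral_translate:
  fixes f :: "'a::euclidean_space \<Rightarrow> ennreal"
  assumes [measurable]: "f \<in> borel_measurable borel"
  shows "(\<integral>\<^sup>+x. f (x - t) \<partial>lborel) = (\<integral>\<^sup>+x. f x \<partial>lborel)"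
  by (subst (2) lborel_distr_translate[of "-t", symmetric]) (simp add: nn_integral_distr)

text \<open>Lebesgue measure is the image of a finite product of one-dimensional ones, so this is
  Fubini over the coordinates. It reduces Gaussian integrals to \<open>normal_density\<close> in one
  variable.\<close>

lemma
  fixes f :: "'a::euclidean_space \<Rightarrow> real \<Rightarrow> 'b::{real_normed_field, banach, second_countable_topology}"
  assumes f: "\<And>b. b \<in> Basis \<Longrightarrow> integrable lborel (f b)"
  shows integrable_lborel_prod: "integrable lborel (\<lambda>x. \<Prod>b\<in>Basis. f b (x \<bullet> b))"
    and integral_lborel_prod:
      "(\<integral>x. (\<Prod>b\<in>Basis. f b (x \<bullet> b)) \<partial>lborel) = (\<Prod>b\<in>Basis. \<integral>x. f b x \<partial>lborel)"
proof -
  interpret product_sigma_finite "\<lambda>b::'a. lborel :: real measure" ..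
  have [measurable]: "\<And>b. b \<in> Basis \<Longrightarrow> f b \<in> borel_measurable borel"
    using f borel_measurable_integrable by force
  have eq: "(\<Prod>b\<in>Basis. f b ((\<Sum>c\<in>Basis. x c *\<^sub>R c) \<bullet> b)) = (\<Prod>b\<in>Basis. f b (x b))" for x
    by (intro prod.cong) auto
  show "integrable lborel (\<lambda>x. \<Prod>b\<in>Basis. f b (x \<bullet> b))"
    unfolding lborel_eq[where 'a='a]
    by (subst integrable_distr_eq) (auto simp: eq intro!: product_integrable_prod f)
  show "(\<integral>x. (\<Prod>b\<in>Basis. f b (x \<bullet> b)) \<partial>lborel) = (\<Prod>b\<in>Basis. \<integral>x. f b x \<partial>lborel)"
    unfolding lborel_eq[where 'a='a]
    by (subst integral_distr) (auto simp: eq intro!: product_integral_prod f)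
qed

section \<open>Gaussians and their Fourier transforms\<close>

definition gauss_kernel :: "real \<Rightarrow> 'a::euclidean_space \<Rightarrow> real" where
  "gauss_kernel s x = (\<Prod>b\<in>Basis. normal_density 0 s (x \<bullet> b))"

definition gauss_hat :: "real \<Rightarrow> 'a::euclidean_space \<Rightarrow> real" where
  "gauss_hat s y = exp (- 2 * pi\<^sup>2 * s\<^sup>2 * (norm y)\<^sup>2)"

lemma norm_squared_Basis: "(norm (x::'a::euclidean_space))\<^sup>2 = (\<Sum>b\<in>Basis. (x \<bullet> b)\<^sup>2)"
  unfolding power2_norm_eq_inner by (subst euclidean_inner) (simp add: power2_eq_square)

text \<open>The product in the definition suits \<open>integral_lborel_prod\<close>; this radial
  form is the one for symmetry, rescaling, pointwise bounds and completing the square.\<close>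

lemma gauss_kernel_eq:
  "gauss_kernel s (x::'a::euclidean_space)
   = (1 / sqrt (2 * pi * s\<^sup>2)) ^ DIM('a) * exp (- (norm x)\<^sup>2 / (2 * s\<^sup>2))"
  by (simp add: gauss_kernel_def normal_density_def prod_dividef norm_squared_Basis
      exp_sum[symmetric] sum_divide_distrib sum_negf power_divide)

lemma gauss_kernel_nonneg [simp]: "0 \<le> gauss_kernel s x"
  by (simp add: gauss_kernel_def prod_nonneg)

lemma gauss_kernel_uminus [simp]: "gauss_kernel s (- x) = gauss_kernel s x"
  by (simp add: gauss_kernel_eq)

lemma gauss_kernel_minus_commute: "gauss_kernel s (x - y) = gauss_kernel s (y - x)"
  by (simp add: gauss_kernel_eq norm_minus_commute)

lemma measurable_gauss_kernel [measurable]: "gauss_kernel s \<in> borel_measurable borel"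
  unfolding gauss_kernel_def by measurable

lemma measurable_gauss_hat [measurable]: "gauss_hat s \<in> borel_measurable borel"
  unfolding gauss_hat_def by measurable

lemma gauss_hat_nonneg [simp]: "0 \<le> gauss_hat s y"
  and gauss_hat_le_1 [simp]: "gauss_hat s y \<le> 1"
  by (simp_all add: gauss_hat_def)

lemma integrable_gauss_kernel: "s > 0 \<Longrightarrow> integrable lborel (gauss_kernel s)"
  unfolding gauss_kernel_def by (intro integrable_lborel_prod) auto

lemma integral_gauss_kernel: "s > 0 \<Longrightarrow> (\<integral>x. gauss_kernel s x \<partial>lborel) = 1"
  unfolding gauss_kernel_def by (subst integral_lborel_prod) auto

text \<open>Rescaling by \<open>s\<close> leaves the characteristic function of the standard normal
  law at \<open>- 2 * pi * s * y\<close>; this is the origin of the exponent in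
  \<open>gauss_hat\<close>.\<close>

lemma fourier_normal_density:
  assumes "s > 0"
  shows "(\<integral>t. exp (- 2 * complex_of_real pi * \<i> * complex_of_real (t * y)) * complex_of_real (normal_density 0 s t) \<partial>lborel)
       = complex_of_real (exp (- 2 * pi\<^sup>2 * s\<^sup>2 * y\<^sup>2))" (is "?L = _")
proof -
  have "?L = \<bar>s\<bar> *\<^sub>R (\<integral>t. exp (- 2 * complex_of_real pi * \<i> * complex_of_real ((0 + s * t) * y)) * complex_of_real (normal_density 0 s (0 + s * t)) \<partial>lborel)"
    using assms by (subst lborel_integral_real_affine[of s _ 0]) auto
  also have "\<dots> = (\<integral>t. std_normal_density t *\<^sub>R iexp ((- 2 * pi * s * y) * t) \<partial>lborel)"
    unfolding integral_scaleR_right[symmetric]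
  proof (intro Bochner_Integration.integral_cong refl)
    fix t
    have 1: "s * normal_density 0 s (0 + s * t) = std_normal_density t"
      using assms by (simp add: normal_density_def real_sqrt_mult power_mult_distrib)
    have 2: "exp (- 2 * complex_of_real pi * \<i> * complex_of_real ((0 + s * t) * y)) = iexp ((- 2 * pi * s * y) * t)"
      by (simp add: mult_ac)
    have "\<bar>s\<bar> *\<^sub>R (iexp ((- 2 * pi * s * y) * t) * complex_of_real (normal_density 0 s (0 + s * t)))
        = iexp ((- 2 * pi * s * y) * t) * complex_of_real (s * normal_density 0 s (0 + s * t))"
      using assms by (simp add: scaleR_conv_of_real)
    then show "\<bar>s\<bar> *\<^sub>R (exp (- 2 * complex_of_real pi * \<i> * complex_of_real ((0 + s * t) * y)) * complex_of_real (normal_density 0 s (0 + s * t)))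
       = std_normal_density t *\<^sub>R iexp ((- 2 * pi * s * y) * t)"
      unfolding 1 2 by (simp add: scaleR_conv_of_real)
  qed
  also have "\<dots> = char std_normal_distribution (- 2 * pi * s * y)"
    unfolding char_def by (subst integral_density) auto
  also have "\<dots> = complex_of_real (exp (- 2 * pi\<^sup>2 * s\<^sup>2 * y\<^sup>2))"
    unfolding char_std_normal_distribution by (simp add: power_mult_distrib mult_ac)
  finally show ?thesis .
qed

lemma fourier_gauss_kernel:
  assumes "s > 0"
  shows "(\<integral>x. fourier_character x y * complex_of_real (gauss_kernel s x) \<partial>lborel)
       = complex_of_real (gauss_hat s (y::'a::euclidean_space))"
proof -
  let ?f = "\<lambda>b t. exp (- 2 * complex_of_real pi * \<i> * complex_of_real (t * (y \<bullet> b))) * complex_of_real (normal_density 0 s t)"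
  have "fourier_character x y * complex_of_real (gauss_kernel s x) = (\<Prod>b\<in>Basis. ?f b (x \<bullet> b))" for x
    unfolding fourier_character_def gauss_kernel_def
    by (subst euclidean_inner) (simp add: prod.distrib exp_sum[symmetric] sum_distrib_left)
  moreover have "integrable lborel (?f b)" for b
    by (rule Bochner_Integration.integrable_bound[of _ "normal_density 0 s"])
       (use assms in \<open>auto simp: norm_mult\<close>)
  ultimately have "(\<integral>x. fourier_character x y * complex_of_real (gauss_kernel s x) \<partial>lborel)
      = (\<Prod>b\<in>Basis. \<integral>t. ?f b t \<partial>lborel)"
    using integral_lborel_prod[of ?f] by simp
  also have "\<dots> = (\<Prod>b\<in>Basis. complex_of_real (exp (- 2 * pi\<^sup>2 * s\<^sup>2 * (y \<bullet> b)\<^sup>2)))"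
    by (simp only: fourier_normal_density[OF assms])
  also have "\<dots> = complex_of_real (gauss_hat s y)"
    by (simp add: gauss_hat_def norm_squared_Basis sum_distrib_left exp_sum del: of_real_exp)
  finally show ?thesis .
qed

text \<open>Up to the factor \<open>gauss_kernel s 0\<close>, the two families coincide after
  replacing the width \<open>s\<close> by the dual width \<open>1 / (2 * pi * s)\<close>. This
  carries integrability and the transform over to \<open>gauss_hat\<close> and so provides inversion
  for Gaussians.\<close>

lemma gauss_hat_conv_kernel:
  assumes "s > 0"
  shows "gauss_hat s (x::'a::euclidean_space) = (1 / sqrt (2 * pi * s\<^sup>2)) ^ DIM('a) * gauss_kernel (1 / (2 * pi * s)) x"
    and "gauss_kernel s x = (1 / sqrt (2 * pi * s\<^sup>2)) ^ DIM('a) * gauss_hat (1 / (2 * pi * s)) x"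
proof -
  have "sqrt (2 * pi * s\<^sup>2) * sqrt (2 * pi * (1 / (2 * pi * s))\<^sup>2) = sqrt 1"
    unfolding real_sqrt_mult[symmetric] using assms by (simp add: field_simps power2_eq_square)
  then have "(1 / sqrt (2 * pi * s\<^sup>2)) ^ DIM('a) * (1 / sqrt (2 * pi * (1 / (2 * pi * s))\<^sup>2)) ^ DIM('a) = 1"
    by (simp add: power_mult_distrib[symmetric])
  moreover have "- (norm x)\<^sup>2 / (2 * (1 / (2 * pi * s))\<^sup>2) = - 2 * pi\<^sup>2 * s\<^sup>2 * (norm x)\<^sup>2"
    using assms by (simp add: field_simps power2_eq_square)
  ultimately show "gauss_hat s x = (1 / sqrt (2 * pi * s\<^sup>2)) ^ DIM('a) * gauss_kernel (1 / (2 * pi * s)) x"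
    unfolding gauss_kernel_eq gauss_hat_def by (simp add: mult.assoc[symmetric])
  have "- 2 * pi\<^sup>2 * (1 / (2 * pi * s))\<^sup>2 * (norm x)\<^sup>2 = - (norm x)\<^sup>2 / (2 * s\<^sup>2)"
    using assms by (simp add: field_simps power2_eq_square)
  then show "gauss_kernel s x = (1 / sqrt (2 * pi * s\<^sup>2)) ^ DIM('a) * gauss_hat (1 / (2 * pi * s)) x"
    unfolding gauss_kernel_eq gauss_hat_def by simp
qed

lemma integrable_gauss_hat: "s > 0 \<Longrightarrow> integrable lborel (gauss_hat s :: 'a::euclidean_space \<Rightarrow> real)"
  by (subst Bochner_Integration.integrable_cong[OF refl gauss_hat_conv_kernel(1)])
     (auto intro!: integrable_mult_right integrable_gauss_kernel)

lemma fourier_gauss_hat: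
  assumes "s > 0"
  shows "(\<integral>x. fourier_character x y * complex_of_real (gauss_hat s x) \<partial>lborel)
       = complex_of_real (gauss_kernel s (y::'a::euclidean_space))"
proof -
  let ?c = "complex_of_real ((1 / sqrt (2 * pi * s\<^sup>2)) ^ DIM('a))"
  have "(\<integral>x. fourier_character x y * complex_of_real (gauss_hat s x) \<partial>lborel)
     = (\<integral>x. ?c * (fourier_character x y * complex_of_real (gauss_kernel (1 / (2 * pi * s)) x)) \<partial>lborel)"
    unfolding gauss_hat_conv_kernel(1)[OF assms] by (simp add: mult_ac)
  also have "\<dots> = ?c * complex_of_real (gauss_hat (1 / (2 * pi * s)) y)"
    using assms by (simp only: integral_mult_right_zero fourier_gauss_kernel zero_less_divide_iff) (simp add: fourier_gauss_kernel)
  finally show ?thesis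
    unfolding gauss_hat_conv_kernel(2)[OF assms] by simp
qed

section \<open>Functions annihilated by all Gaussians\<close>

lemma lborel_integral_affine:
  fixes f :: "'a::euclidean_space \<Rightarrow> 'b::{banach, second_countable_topology}"
  assumes [measurable]: "f \<in> borel_measurable borel" and "c \<noteq> 0"
  shows "(\<integral>x. f x \<partial>lborel) = \<bar>c\<bar> ^ DIM('a) *\<^sub>R (\<integral>x. f (t + c *\<^sub>R x) \<partial>lborel)"
proof -
  have "(\<integral>x. f x \<partial>lborel) = (\<integral>x. f x \<partial>density (distr lborel borel (\<lambda>x. t + c *\<^sub>R x)) (\<lambda>_. ennreal (\<bar>c\<bar> ^ DIM('a))))"
    using lborel_affine[OF assms(2), of t] by simp
  also have "\<dots> = (\<integral>x. \<bar>c\<bar> ^ DIM('a) *\<^sub>R f x \<partial>distr lborel borel (\<lambda>x. t + c *\<^sub>R x))"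
    by (rule integral_density) auto
  finally show ?thesis by (simp add: integral_distr)
qed

lemma gauss_kernel_scale:
  assumes "s > 0"
  shows "s ^ DIM('a) * gauss_kernel s (s *\<^sub>R (z::'a::euclidean_space)) = gauss_kernel 1 z"
proof -
  have "(norm (s *\<^sub>R z))\<^sup>2 / (2 * s\<^sup>2) = (norm z)\<^sup>2 / 2"
    using assms by (simp add: power_mult_distrib)
  moreover have "s ^ DIM('a) * (1 / sqrt (2 * pi * s\<^sup>2)) ^ DIM('a) = (1 / sqrt (2 * pi * 1\<^sup>2)) ^ DIM('a)"
    unfolding power_mult_distrib[symmetric] using assms by (simp add: real_sqrt_mult)
  ultimately show ?thesis unfolding gauss_kernel_eq by (simp add: mult.assoc[symmetric])
qed

text \<open>Substituting \<open>x + s k *\<^sub>R z\<close> for \<open>t\<close> replaces the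
  shrinking kernel by the fixed \<open>gauss_kernel 1\<close>, so that
  \<open>B * gauss_kernel 1 z\<close> dominates. Continuity is asked at one point only, since
  \<open>u\<close> will be the indicator of a box.\<close>

lemma gauss_kernel_approximate_identity:
  fixes u :: "'a::euclidean_space \<Rightarrow> real"
  assumes [measurable]: "u \<in> borel_measurable borel" and B: "\<And>x. \<bar>u x\<bar> \<le> B"
    and "isCont u x" "s \<longlonglongrightarrow> 0" and s: "\<And>k. s k > 0"
  shows "(\<lambda>k. \<integral>t. u t * gauss_kernel (s k) (t - x) \<partial>lborel) \<longlonglongrightarrow> u x"
proof -
  have "(\<integral>t. u t * gauss_kernel (s k) (t - x) \<partial>lborel)
      = (\<integral>z. u (x + s k *\<^sub>R z) * gauss_kernel 1 z \<partial>lborel)" for k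
  proof -
    have "(\<integral>t. u t * gauss_kernel (s k) (t - x) \<partial>lborel)
        = (\<integral>z. s k ^ DIM('a) * (u (x + s k *\<^sub>R z) * gauss_kernel (s k) (s k *\<^sub>R z)) \<partial>lborel)"
      using s[of k] by (subst lborel_integral_affine[of _ "s k" x]) auto
    also have "\<dots> = (\<integral>z. u (x + s k *\<^sub>R z) * gauss_kernel 1 z \<partial>lborel)"
      by (simp only: gauss_kernel_scale[OF s[of k], symmetric] mult_ac)
    finally show ?thesis .
  qed
  moreover have "(\<lambda>k. \<integral>z. u (x + s k *\<^sub>R z) * gauss_kernel 1 z \<partial>lborel) \<longlonglongrightarrow> (\<integral>z. u x * gauss_kernel 1 (z::'a) \<partial>lborel)"
  proof (rule integral_dominated_convergence[where w = "\<lambda>z. B * gauss_kernel 1 z"])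
    show "AE z in lborel. (\<lambda>k. u (x + s k *\<^sub>R z) * gauss_kernel 1 z) \<longlonglongrightarrow> u x * gauss_kernel 1 z"
    proof (intro AE_I2 tendsto_mult_right)
      fix z
      have "(\<lambda>k. x + s k *\<^sub>R z) \<longlonglongrightarrow> x + 0 *\<^sub>R z" by (intro tendsto_intros assms)
      then show "(\<lambda>k. u (x + s k *\<^sub>R z)) \<longlonglongrightarrow> u x"
        using isCont_tendsto_compose[OF assms(3)] by simp
    qed
    show "AE z in lborel. norm (u (x + s k *\<^sub>R z) * gauss_kernel 1 z) \<le> B * gauss_kernel 1 z" for k
      using B by (intro AE_I2) (simp add: abs_mult mult_right_mono)
  qed (auto intro!: integrable_mult_right integrable_gauss_kernel)
  ultimately show ?thesis by (simp add: integral_gauss_kernel)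
qed

lemma integrable_convolution:
  fixes f g :: "'a::euclidean_space \<Rightarrow> 'b::{real_normed_field, banach, second_countable_topology}"
  assumes f: "integrable lborel f" and g: "integrable lborel g"
  shows "integrable (lborel \<Otimes>\<^sub>M lborel) (\<lambda>(x, t). f x * g (t - x))"
proof (rule lborel_pair.Fubini_integrable)
  have [measurable]: "f \<in> borel_measurable borel" "g \<in> borel_measurable borel" using f g by auto
  show "(\<lambda>(x, t). f x * g (t - x)) \<in> borel_measurable (lborel \<Otimes>\<^sub>M lborel)" by measurable
  have g': "integrable lborel (\<lambda>t. g (t - x))" for x
    using lborel_integrable_reflect[OF lborel_integrable_reflect[OF g, of 0], of x] by simp
  then show "AE x in lborel. integrable lborel (\<lambda>t. case (x, t) of (x, t) \<Rightarrow> f x * g (t - x))"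
    by simp
  have "(\<integral>t. norm (f x * g (t - x)) \<partial>lborel) = norm (f x) * (\<integral>t. norm (g t) \<partial>lborel)" for x
    using lborel_integral_translate[of "\<lambda>t. norm (g t)" "- x"] by (simp add: norm_mult)
  then show "integrable lborel (\<lambda>x. \<integral>t. norm (case (x, t) of (x, t) \<Rightarrow> f x * g (t - x)) \<partial>lborel)"
    using f by simp
qed

lemma AE_lborel_cbox_box: "AE x in lborel. x \<in> cbox a b \<longrightarrow> x \<in> box a (b::'a::euclidean_space)"
proof -
  have "emeasure lborel (cbox a b - box a b) = emeasure lborel (cbox a b) - emeasure lborel (box a b)"
    by (rule emeasure_Diff) (auto simp: box_subset_cbox emeasure_lborel_box_eq)
  also have "\<dots> = 0" by (simp add: emeasure_lborel_box_eq emeasure_lborel_cbox_eq box_eq_empty)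
  finally show ?thesis by (intro AE_I[of _ _ "cbox a b - box a b"]) auto
qed

lemma isCont_indicator_box:
  fixes x :: "'a::euclidean_space"
  assumes "x \<in> cbox a b \<longrightarrow> x \<in> box a b"
  shows "isCont (indicator (box a b) :: 'a \<Rightarrow> real) x"
proof (cases "x \<in> box a b")
  case True
  have "eventually (\<lambda>y. indicator (box a b) y = (1::real)) (nhds x)"
    using eventually_nhds_in_open[OF open_box True] by eventually_elim simp
  then show ?thesis by (subst isCont_cong) auto
next
  case False
  then have "x \<in> - cbox a b" using assms by auto
  then have "eventually (\<lambda>y. y \<in> - cbox a b) (nhds x)"
    by (intro eventually_nhds_in_open) (auto simp: closed_cbox open_Compl)
  then have "eventually (\<lambda>y. indicator (box a b) y = (0::real)) (nhds x)"
    by eventually_elim (use box_subset_cbox[of a b] in \<open>auto simp: indicator_def\<close>)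
  then show ?thesis by (subst isCont_cong) auto
qed

text \<open>Since \<open>ennreal\<close> sends negative reals to 0, \<open>?P\<close> and
  \<open>?N\<close> have the positive and the negative part of \<open>w\<close> as densities. They
  are finite and agree on boxes, an intersection-stable generator, hence are equal; and a real
  number whose positive and negative parts coincide is 0.\<close>

lemma AE_zero_if_box_integrals_zero:
  fixes w :: "'a::euclidean_space \<Rightarrow> real"
  assumes w: "integrable lborel w"
    and zero: "\<And>a b. (\<integral>x. indicator (box a b) x * w x \<partial>lborel) = 0"
  shows "AE x in lborel. w x = 0"
proof -
  have [measurable]: "w \<in> borel_measurable borel" using w by auto
  let ?P = "density lborel (\<lambda>x. ennreal (w x))" and ?N = "density lborel (\<lambda>x. ennreal (- w x))"
  have fin: "(\<integral>\<^sup>+x. ennreal (w x) \<partial>lborel) \<noteq> \<infinity>" "(\<integral>\<^sup>+x. ennreal (- w x) \<partial>lborel) \<noteq> \<infinity>"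
    using w by (auto simp: real_integrable_def)
  have enn2real_inj: "A = B" if "A \<noteq> \<infinity>" "B \<noteq> \<infinity>" "enn2real A = enn2real B" for A B :: ennreal
    using that by (cases A; cases B) auto
  have "?P = ?N"
  proof (rule measure_eqI_generator_eq[where E="range (\<lambda>(a, b). box a b)" and \<Omega>=UNIV
        and A="\<lambda>n. box (- (real n *\<^sub>R One)) (real n *\<^sub>R One)"])
    show "Int_stable (range (\<lambda>(a, b). box a b) :: 'a set set)"
      by (auto simp: Int_stable_def box_Int_box)
    show "emeasure ?P X = emeasure ?N X" if "X \<in> range (\<lambda>(a, b). box a b)" for X
    proof -
      obtain a b where X: "X = box a b" using \<open>X \<in> _\<close> by auto
      have i: "integrable lborel (\<lambda>x. indicator (box a b) x * w x)"
        using integrable_mult_indicator[OF _ w, of "box a b"] by simp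
      have e: "ennreal (r x) * indicator (box a b) x = ennreal (indicator (box a b) x * r x)" for r x
        by (auto simp: indicator_def)
      have "(\<integral>\<^sup>+x. ennreal (indicator (box a b) x * w x) \<partial>lborel) \<noteq> \<infinity>"
        "(\<integral>\<^sup>+x. ennreal (- (indicator (box a b) x * w x)) \<partial>lborel) \<noteq> \<infinity>"
        using i by (auto simp: real_integrable_def)
      moreover have "enn2real (\<integral>\<^sup>+x. ennreal (indicator (box a b) x * w x) \<partial>lborel)
          = enn2real (\<integral>\<^sup>+x. ennreal (- (indicator (box a b) x * w x)) \<partial>lborel)"
        using zero[of a b] real_lebesgue_integral_def[OF i] by simp
      ultimately have "(\<integral>\<^sup>+x. ennreal (indicator (box a b) x * w x) \<partial>lborel)
          = (\<integral>\<^sup>+x. ennreal (- (indicator (box a b) x * w x)) \<partial>lborel)"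
        by (rule enn2real_inj)
      then show ?thesis
        unfolding X by (subst (1 2) emeasure_density) (auto simp: e e[of "\<lambda>x. - w x", simplified])
    qed
    show "emeasure ?P (box (- (real n *\<^sub>R One)) (real n *\<^sub>R One)) \<noteq> \<infinity>" for n
    proof -
      have "emeasure ?P (box (- (real n *\<^sub>R One)) (real n *\<^sub>R One)) \<le> emeasure ?P (space ?P)"
        by (rule emeasure_space)
      also have "\<dots> < \<infinity>" using fin by (simp add: emeasure_density less_top)
      finally show ?thesis by simp
    qed
  qed (auto simp: borel_eq_box UN_box_eq_UNIV)
  then have "AE x in lborel. ennreal (w x) = ennreal (- w x)"
    by (intro sigma_finite_measure.density_unique[OF lborel.sigma_finite_measure_axioms]) auto
  then show ?thesis
  proof eventually_elim
    case (elim x)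
    then show ?case by (cases "w x \<ge> 0") (auto simp: ennreal_neg)
  qed
qed

text \<open>Completing the square shows that all convolutions of the damped function
  \<open>w\<close> with Gaussian kernels vanish. Indicators of boxes are limits of their own
  convolutions with such kernels, so \<open>w\<close> has integral 0 over every box.\<close>

lemma AE_zero_if_gauss_integrals_zero:
  fixes v :: "'a::euclidean_space \<Rightarrow> real"
  assumes [measurable]: "v \<in> borel_measurable borel"
    and int: "\<And>a c. c > 0 \<Longrightarrow> integrable lborel (\<lambda>x. v x * exp (- c * (norm (x - a))\<^sup>2))"
    and zero: "\<And>a c. c > 0 \<Longrightarrow> (\<integral>x. v x * exp (- c * (norm (x - a))\<^sup>2) \<partial>lborel) = 0"
  shows "AE x in lborel. v x = 0"
proof -
  \<comment> \<open>\<open>v\<close> is only known to be integrable against Gaussians; the weight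
    yields an integrable function and, being positive, has the same zeros.\<close>
  define w where "w x = v x * exp (- (norm x)\<^sup>2)" for x
  have w: "integrable lborel w" using int[of 1 0] unfolding w_def by simp
  then have [measurable]: "w \<in> borel_measurable borel" by simp
  have conv0: "(\<integral>x. w x * gauss_kernel s (t - x) \<partial>lborel) = 0" if s: "s > 0" for s t
  proof -
    \<comment> \<open>\<kappa> is the exponent of \<open>gauss_kernel s\<close>, the weight in
      \<open>w\<close> has exponent 1, and \<open>a\<close> is the centre that completes the square:
      weight times kernel is a constant multiple of a Gaussian of exponent 1 + \<kappa> about
      \<open>a\<close>.\<close>
    define \<kappa> where "\<kappa> = 1 / (2 * s\<^sup>2)"
    define a where "a = (\<kappa> / (1 + \<kappa>)) *\<^sub>R t"
    have k: "\<kappa> > 0" using s by (simp add: \<kappa>_def)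
    have E: "(norm x)\<^sup>2 + \<kappa> * (norm (t - x))\<^sup>2
        = (1 + \<kappa>) * (norm (x - a))\<^sup>2 + (\<kappa> * (norm t)\<^sup>2 - (1 + \<kappa>) * (norm a)\<^sup>2)" for x
    proof -
      have "(1 + \<kappa>) * (x \<bullet> a) = \<kappa> * (x \<bullet> t)" using k by (simp add: a_def)
      then show ?thesis
        unfolding power2_norm_eq_inner by (simp add: algebra_simps inner_commute)
    qed
    have "exp (- (norm x)\<^sup>2) * exp (- \<kappa> * (norm (t - x))\<^sup>2)
        = exp (- (1 + \<kappa>) * (norm (x - a))\<^sup>2) * exp (- (\<kappa> * (norm t)\<^sup>2 - (1 + \<kappa>) * (norm a)\<^sup>2))" for x
      using E[of x] unfolding exp_add[symmetric] by (simp add: algebra_simps)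
    moreover have "gauss_kernel s (t - x) = (1 / sqrt (2 * pi * s\<^sup>2)) ^ DIM('a) * exp (- \<kappa> * (norm (t - x))\<^sup>2)" for x
      unfolding gauss_kernel_eq by (simp add: \<kappa>_def)
    ultimately have "w x * gauss_kernel s (t - x)
        = (1 / sqrt (2 * pi * s\<^sup>2)) ^ DIM('a) * exp (- (\<kappa> * (norm t)\<^sup>2 - (1 + \<kappa>) * (norm a)\<^sup>2))
          * (v x * exp (- (1 + \<kappa>) * (norm (x - a))\<^sup>2))" for x
      by (simp add: w_def mult_ac)
    then show ?thesis using zero[of "1 + \<kappa>" a] k by simp
  qed
  have "(\<integral>x. indicator (box a b) x * w x \<partial>lborel) = 0" for a b
  proof -
    define u :: "'a \<Rightarrow> real" where "u = indicator (box a b)"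
    have [measurable]: "u \<in> borel_measurable borel" unfolding u_def by simp
    have u01: "0 \<le> u x" "u x \<le> 1" for x by (simp_all add: u_def indicator_def)
    define s where "s k = 1 / real (Suc k)" for k
    have s: "s k > 0" "s \<longlonglongrightarrow> 0" for k
      unfolding s_def using LIMSEQ_inverse_real_of_nat by (simp_all add: inverse_eq_divide)
    let ?U = "\<lambda>k x. \<integral>t. u t * gauss_kernel (s k) (t - x) \<partial>lborel"
    have U1: "\<bar>?U k x\<bar> \<le> 1" for k x
    proof -
      have g: "integrable lborel (\<lambda>t. gauss_kernel (s k) (t - x))"
        using lborel_integrable_reflect[OF integrable_gauss_kernel[OF s(1)[of k]], where t = x]
        by (simp add: gauss_kernel_minus_commute)
      have "\<bar>?U k x\<bar> \<le> (\<integral>t. \<bar>u t * gauss_kernel (s k) (t - x)\<bar> \<partial>lborel)"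
        by (rule integral_abs_bound)
      also have "\<dots> \<le> (\<integral>t. gauss_kernel (s k) (t - x) \<partial>lborel)"
        by (rule Bochner_Integration.integral_mono')
           (use g u01 in \<open>auto simp: abs_mult mult_left_le_one_le\<close>)
      also have "\<dots> = 1"
        using lborel_integral_translate[of "gauss_kernel (s k)" "- x"] integral_gauss_kernel[OF s(1)] by simp
      finally show ?thesis .
    qed
    have "(\<lambda>k. \<integral>x. w x * ?U k x \<partial>lborel) \<longlonglongrightarrow> (\<integral>x. w x * u x \<partial>lborel)"
    proof (rule integral_dominated_convergence[where w = "\<lambda>x. \<bar>w x\<bar>"])
      show "AE x in lborel. (\<lambda>k. w x * ?U k x) \<longlonglongrightarrow> w x * u x"
        \<comment> \<open>The boundary of the box is a null set, and off it the indicator is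
          continuous.\<close>
        using AE_lborel_cbox_box[of a b]
      proof eventually_elim
        case (elim x)
        then have "isCont u x" unfolding u_def by (rule isCont_indicator_box)
        then show ?case
          using u01 s by (intro tendsto_mult_left gauss_kernel_approximate_identity[where B=1]) auto
      qed
      show "AE x in lborel. norm (w x * ?U k x) \<le> \<bar>w x\<bar>" for k
        using U1 by (intro AE_I2) (simp add: abs_mult mult_left_le)
    qed (use w in auto)
    moreover have "(\<integral>x. w x * ?U k x \<partial>lborel) = 0" for k
    proof -
      \<comment> \<open>Exchanging the integrals moves the kernel from \<open>u\<close> to
        \<open>w\<close>, where \<open>conv0\<close> annihilates the inner integral.\<close>
      have "integrable (lborel \<Otimes>\<^sub>M lborel) (\<lambda>(x, t). u t * (w x * gauss_kernel (s k) (t - x)))"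
        by (rule Bochner_Integration.integrable_bound[OF integrable_convolution[OF w integrable_gauss_kernel[OF s(1)[of k]]]])
           (use u01 in \<open>auto simp: abs_mult mult_left_le_one_le\<close>)
      from lborel_pair.Fubini_integral[OF this]
      have "(\<integral>x. (\<integral>t. w x * (u t * gauss_kernel (s k) (t - x)) \<partial>lborel) \<partial>lborel)
         = (\<integral>t. (\<integral>x. u t * (w x * gauss_kernel (s k) (t - x)) \<partial>lborel) \<partial>lborel)"
        by (simp only: prod.case mult.left_commute[of "u _" "w _"])
      then show ?thesis by (simp add: conv0 s)
    qed
    ultimately show ?thesis unfolding u_def by (simp add: LIMSEQ_const_iff mult.commute)
  qed
  then have "AE x in lborel. w x = 0" by (rule AE_zero_if_box_integrals_zero[OF w])
  then show ?thesis by eventually_elim (simp add: w_def)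
qed

section \<open>Schwartz functions\<close>

text \<open>For the induction in \<open>schwartz_gauss\<close>: in a fixed direction
  \<open>b\<close> the derivative is again a polynomial in the base point, so differentiation can be
  repeated.\<close>

lemma real_polynomial_function_has_derivative:
  fixes p :: "'a::real_normed_vector \<Rightarrow> real"
  assumes "real_polynomial_function p"
  obtains D where "\<And>x. (p has_derivative D x) (at x)" "\<And>b. real_polynomial_function (\<lambda>x. D x b)"
proof -
  have "\<exists>D. (\<forall>x. (p has_derivative D x) (at x)) \<and> (\<forall>b. real_polynomial_function (\<lambda>x. D x b))"
    using assms
  proof induction
    case (linear f)
    then show ?case
      by (intro exI[of _ "\<lambda>_. f"]) (auto intro: bounded_linear_imp_has_derivative real_polynomial_function.intros)
  next
    case (const c)
    then show ?case
      by (intro exI[of _ "\<lambda>_ _. 0"]) (auto intro: real_polynomial_function.intros)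
  next
    case (add f g)
    then obtain D E where
      "\<And>x. (f has_derivative D x) (at x)" "\<And>b. real_polynomial_function (\<lambda>x. D x b)"
      "\<And>x. (g has_derivative E x) (at x)" "\<And>b. real_polynomial_function (\<lambda>x. E x b)"
      by blast
    then show ?case
      by (intro exI[of _ "\<lambda>x h. D x h + E x h"])
         (auto intro: has_derivative_add real_polynomial_function.intros)
  next
    case (mult f g)
    then obtain D E where
      "\<And>x. (f has_derivative D x) (at x)" "\<And>b. real_polynomial_function (\<lambda>x. D x b)"
      "\<And>x. (g has_derivative E x) (at x)" "\<And>b. real_polynomial_function (\<lambda>x. E x b)"
      by blast
    with mult.hyps show ?case
      by (intro exI[of _ "\<lambda>x h. f x * E x h + D x h * g x"])
         (auto intro!: has_derivative_mult real_polynomial_function.intros(3,4))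
  qed
  then show ?thesis using that by blast
qed

lemma real_polynomial_function_growth:
  fixes p :: "'a::real_normed_vector \<Rightarrow> real"
  assumes "real_polynomial_function p"
  obtains K m where "\<And>x. \<bar>p x\<bar> \<le> K * (1 + norm x) ^ m"
proof -
  have "\<exists>K m. K \<ge> 0 \<and> (\<forall>x. \<bar>p x\<bar> \<le> K * (1 + norm x) ^ m)"
    using assms
  proof induction
    case (linear f)
    then obtain K where K: "K \<ge> 0" "\<And>x. norm (f x) \<le> norm x * K"
      using bounded_linear.nonneg_bounded by blast
    have "\<bar>f x\<bar> \<le> K * (1 + norm x) ^ 1" for x
      using K(2)[of x] K(1) by (simp add: algebra_simps)
    then show ?case using K(1) by blast
  next
    case (const c)
    have "\<bar>c\<bar> \<le> \<bar>c\<bar> * (1 + norm (x::'a)) ^ 0" for x by simp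
    then show ?case using abs_ge_zero by blast
  next
    case (add f g)
    then obtain K m L k where h: "K \<ge> 0" "\<And>x. \<bar>f x\<bar> \<le> K * (1 + norm x) ^ m"
      "L \<ge> 0" "\<And>x. \<bar>g x\<bar> \<le> L * (1 + norm x) ^ k" by blast
    have "\<bar>f x + g x\<bar> \<le> (K + L) * (1 + norm x) ^ (m + k)" for x
    proof -
      have "\<bar>f x + g x\<bar> \<le> K * (1 + norm x) ^ m + L * (1 + norm x) ^ k"
        using h(2,4)[of x] by linarith
      also have "\<dots> \<le> K * (1 + norm x) ^ (m + k) + L * (1 + norm x) ^ (m + k)"
        using h(1,3) by (intro add_mono mult_left_mono power_increasing) auto
      finally show ?thesis by (simp add: distrib_right)
    qed
    then show ?case using h(1,3) by (intro exI[of _ "K + L"] exI[of _ "m + k"]) auto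
  next
    case (mult f g)
    then obtain K m L k where h: "K \<ge> 0" "\<And>x. \<bar>f x\<bar> \<le> K * (1 + norm x) ^ m"
      "L \<ge> 0" "\<And>x. \<bar>g x\<bar> \<le> L * (1 + norm x) ^ k" by blast
    have "\<bar>f x * g x\<bar> \<le> (K * L) * (1 + norm x) ^ (m + k)" for x
      using mult_mono[OF h(2)[of x] h(4)[of x]] h(1,3) by (simp add: abs_mult power_add mult_ac)
    then show ?case using h(1,3) by (intro exI[of _ "K * L"] exI[of _ "m + k"]) auto
  qed
  then show ?thesis using that by blast
qed

text \<open>With \<open>r = norm (x - a)\<close>, the polynomial factor is at most a constant times
  \<open>exp (m * r)\<close>, by \<open>1 + r \<le> exp r\<close>. The maximum of
  \<open>m * r - c * r\<^sup>2\<close> over real \<open>r\<close> is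
  \<open>m\<^sup>2 / (4 * c)\<close>.\<close>

lemma polynomial_times_gauss_bounded:
  fixes a :: "'a::real_normed_vector"
  assumes "c > 0"
  obtains K where "\<And>x. (1 + norm x) ^ m * exp (- c * (norm (x - a))\<^sup>2) \<le> K"
proof
  fix x
  let ?r = "norm (x - a)"
  have "1 + norm x \<le> (1 + norm a) * (1 + ?r)"
    using norm_triangle_sub[of x a] mult_nonneg_nonneg[OF norm_ge_zero norm_ge_zero, of a "x - a"]
    unfolding distrib_left distrib_right by linarith
  also have "\<dots> \<le> (1 + norm a) * exp ?r"
    by (intro mult_left_mono exp_ge_add_one_self) auto
  finally have "(1 + norm x) ^ m \<le> (1 + norm a) ^ m * exp (real m * ?r)"
    using power_mono[of "1 + norm x" "(1 + norm a) * exp ?r" m]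
    by (simp add: power_mult_distrib exp_of_nat_mult)
  then have "(1 + norm x) ^ m * exp (- c * ?r\<^sup>2) \<le> (1 + norm a) ^ m * exp (real m * ?r) * exp (- c * ?r\<^sup>2)"
    by (intro mult_right_mono) auto
  also have "\<dots> = (1 + norm a) ^ m * exp (real m * ?r - c * ?r\<^sup>2)"
    by (simp add: exp_diff exp_minus field_simps)
  also have "\<dots> \<le> (1 + norm a) ^ m * exp ((real m)\<^sup>2 / (4 * c))"
  proof -
    have "0 \<le> (real m - 2 * c * ?r)\<^sup>2" by simp
    then have "real m * ?r - c * ?r\<^sup>2 \<le> (real m)\<^sup>2 / (4 * c)"
      using assms by (simp add: field_simps power2_eq_square)
    then show ?thesis by (intro mult_left_mono) auto
  qed
  finally show "(1 + norm x) ^ m * exp (- c * ?r\<^sup>2) \<le> (1 + norm a) ^ m * exp ((real m)\<^sup>2 / (4 * c))" .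
qed

text \<open>Polynomials times the fixed Gaussian form a class closed under directional derivatives,
  and each member decays faster than any power. Arbitrary centre and width are what the uniqueness
  argument tests with.\<close>

lemma schwartz_gauss:
  fixes a :: "'a::euclidean_space"
  assumes "c > 0"
  shows "schwartz (\<lambda>x. complex_of_real (exp (- c * (norm (x - a))\<^sup>2)))"
proof -
  let ?E = "\<lambda>x. exp (- c * (norm (x - a))\<^sup>2)"
  define f where "f x = complex_of_real (?E x)" for x
  have dE: "(?E has_derivative (\<lambda>h. - 2 * c * ((x - a) \<bullet> h) * ?E x)) (at x)" for x
    unfolding power2_norm_eq_inner
    by (auto intro!: derivative_eq_intros simp: inner_commute algebra_simps)
  have deriv: "((\<lambda>x. complex_of_real (p x * ?E x)) has_derivative
      (\<lambda>h. complex_of_real ((D h - 2 * c * p x * ((x - a) \<bullet> h)) * ?E x))) (at x)"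
    if "(p has_derivative D) (at x)" for p D x
    using has_derivative_of_real[OF has_derivative_mult[OF that dE[of x]], where 'a=complex]
    by (rule has_derivative_eq_rhs) (simp add: fun_eq_iff algebra_simps flip: of_real_mult of_real_add of_real_diff)
  have step: "\<exists>q. real_polynomial_function q \<and>
      (\<forall>x. frechet_derivative (\<lambda>x. complex_of_real (p x * ?E x)) (at x) b = complex_of_real (q x * ?E x))"
    if p: "real_polynomial_function p" for p b
  proof -
    obtain D where D: "\<And>x. (p has_derivative D x) (at x)" "\<And>b. real_polynomial_function (\<lambda>x. D x b)"
      using real_polynomial_function_has_derivative[OF p] by blast
    have "real_polynomial_function (\<lambda>x. (x - a) \<bullet> b)"
    proof -
      have "real_polynomial_function (\<lambda>x. x \<bullet> b + (- (a \<bullet> b)))"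
        by (intro real_polynomial_function.intros bounded_linear_inner_left)
      then show ?thesis by (simp add: inner_diff_left)
    qed
    then have "real_polynomial_function (\<lambda>x. D x b + (- 2 * c) * (p x * ((x - a) \<bullet> b)))"
      using p D(2)
      by (intro real_polynomial_function.intros(2-4))
    moreover have "frechet_derivative (\<lambda>x. complex_of_real (p x * ?E x)) (at x) b
       = complex_of_real ((D x b + (- 2 * c) * (p x * ((x - a) \<bullet> b))) * ?E x)" for x
      by (subst frechet_derivative_at[OF deriv[OF D(1)], symmetric]) (simp add: mult_ac)
    ultimately show ?thesis by blast
  qed
  have it: "\<exists>p. real_polynomial_function p \<and> iterated_partial bs f = (\<lambda>x. complex_of_real (p x * ?E x))" for bs
  proof (induction bs)
    case Nil
    show ?case
      by (intro exI[of _ "\<lambda>_. 1"]) (auto simp: f_def intro: real_polynomial_function.intros)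
  next
    case (Cons b bs)
    then obtain p where p: "real_polynomial_function p"
      "iterated_partial bs f = (\<lambda>x. complex_of_real (p x * ?E x))" by blast
    obtain q where "real_polynomial_function q"
      "\<And>x. frechet_derivative (\<lambda>x. complex_of_real (p x * ?E x)) (at x) b = complex_of_real (q x * ?E x)"
      using step[OF p(1)] by blast
    then show ?case unfolding iterated_partial.simps p(2) by auto
  qed
  have "schwartz f"
    unfolding schwartz_def
  proof (intro allI impI conjI)
    fix bs :: "'a list" and x
    obtain p where p: "real_polynomial_function p"
      "iterated_partial bs f = (\<lambda>x. complex_of_real (p x * ?E x))" using it by blast
    obtain D where D: "\<And>x. (p has_derivative D x) (at x)"
      using real_polynomial_function_has_derivative[OF p(1)] by blast
    show "iterated_partial bs f differentiable (at x)"
      unfolding p(2) differentiable_def using deriv[OF D[of x]] by blast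
  next
    fix bs :: "'a list" and k
    obtain p where p: "real_polynomial_function p"
      "iterated_partial bs f = (\<lambda>x. complex_of_real (p x * ?E x))" using it by blast
    obtain K m where K: "\<And>x. \<bar>p x\<bar> \<le> K * (1 + norm x) ^ m"
      using real_polynomial_function_growth[OF p(1)] by blast
    obtain L where L: "\<And>x. (1 + norm x) ^ (k + m) * ?E x \<le> L"
      using polynomial_times_gauss_bounded[OF assms] by blast
    have K0: "K \<ge> 0" using K[of 0] by simp
    have "norm (norm x ^ k *\<^sub>R iterated_partial bs f x) \<le> K * L" for x
    proof -
      have "norm (norm x ^ k *\<^sub>R iterated_partial bs f x) = norm x ^ k * (\<bar>p x\<bar> * ?E x)"
        unfolding p(2) by (simp add: norm_mult abs_mult)
      also have "\<dots> \<le> (1 + norm x) ^ k * (K * (1 + norm x) ^ m * ?E x)"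
        using K0 by (intro mult_mono K power_mono) auto
      also have "\<dots> = K * ((1 + norm x) ^ (k + m) * ?E x)" by (simp add: power_add mult_ac)
      also have "\<dots> \<le> K * L" by (intro mult_left_mono L K0)
      finally show ?thesis .
    qed
    then show "bounded (range (\<lambda>x. norm x ^ k *\<^sub>R iterated_partial bs f x))"
      unfolding bounded_iff by blast
  qed
  then show ?thesis unfolding f_def .
qed

section \<open>Integrability of Schwartz functions\<close>

lemma integrable_inverse_1_plus_square_lborel: "integrable lborel (\<lambda>x::real. inverse (1 + x\<^sup>2))"
  using integrable_inverse_1_plus_square by (simp add: set_integrable_def einterval_def)

lemma schwartz_continuous: "schwartz \<psi> \<Longrightarrow> continuous_on UNIV \<psi>"
  unfolding schwartz_def
  by (auto simp: continuous_on_eq_continuous_within dest!: spec[of _ "[]"]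
      intro: differentiable_imp_continuous_within)

lemma schwartz_measurable: "schwartz \<psi> \<Longrightarrow> \<psi> \<in> borel_measurable borel"
  by (intro borel_measurable_continuous_onI schwartz_continuous)

text \<open>The comparison function is the product of
  \<open>inverse (1 + (x \<bullet> b)\<^sup>2)\<close> over the coordinates, integrable by Fubini.
  Its reciprocal is at most \<open>2 ^ n * (1 + norm x ^ (2 * n))\<close> in dimension
  \<open>n\<close>, so decay of orders 0 and \<open>2 * n\<close> suffices.\<close>

lemma schwartz_integrable:
  fixes \<psi> :: "'a::euclidean_space \<Rightarrow> complex"
  assumes "schwartz \<psi>"
  shows "integrable lborel \<psi>"
proof -
  let ?n = "DIM('a)"
  have bd: "bounded (range (\<lambda>x. norm x ^ k *\<^sub>R \<psi> x))" for k
    using assms unfolding schwartz_def by (auto dest!: spec[of _ "[]"])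
  obtain K where K: "\<And>x. norm (\<psi> x) \<le> K" using bd[of 0] by (auto simp: bounded_iff)
  obtain L where L: "\<And>x. norm x ^ (2 * ?n) * norm (\<psi> x) \<le> L"
    using bd[of "2 * ?n"] by (auto simp: bounded_iff)
  let ?g = "\<lambda>x. \<Prod>b\<in>Basis. inverse (1 + (x \<bullet> b)\<^sup>2) :: real"
  have "norm (\<psi> x) \<le> norm (2 ^ ?n * (K + L) * ?g x)" for x :: 'a
  proof -
    have pos: "(\<Prod>b\<in>Basis. 1 + (x \<bullet> b)\<^sup>2) > 0" by (intro prod_pos) (simp add: add_pos_nonneg)
    have "(\<Prod>b\<in>Basis. 1 + (x \<bullet> b)\<^sup>2) \<le> (\<Prod>b\<in>(Basis::'a set). 1 + (norm x)\<^sup>2)"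
      by (intro prod_mono) (auto simp: abs_le_square_iff[symmetric] Basis_le_norm)
    also have "\<dots> = (1 + (norm x)\<^sup>2) ^ ?n" by simp
    also have "\<dots> \<le> 2 ^ ?n * (1 + norm x ^ (2 * ?n))"
    proof (cases "norm x \<le> 1")
      case True
      then have "(1 + (norm x)\<^sup>2) ^ ?n \<le> 2 ^ ?n"
        by (intro power_mono) (auto simp: power_le_one)
      then show ?thesis by (rule order_trans) simp
    next
      case False
      then have "(1 + (norm x)\<^sup>2) ^ ?n \<le> (2 * (norm x)\<^sup>2) ^ ?n"
        by (intro power_mono) (auto simp: one_le_power)
      also have "\<dots> = 2 ^ ?n * norm x ^ (2 * ?n)" by (simp add: power_mult_distrib power_mult)
      finally show ?thesis by (rule order_trans) simp
    qed
    finally have "norm (\<psi> x) * (\<Prod>b\<in>Basis. 1 + (x \<bullet> b)\<^sup>2) \<le> norm (\<psi> x) * (2 ^ ?n * (1 + norm x ^ (2 * ?n)))"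
      by (intro mult_left_mono) auto
    also have "\<dots> = 2 ^ ?n * (norm (\<psi> x) + norm x ^ (2 * ?n) * norm (\<psi> x))"
      by (simp add: algebra_simps)
    also have "\<dots> \<le> 2 ^ ?n * (K + L)" using K[of x] L[of x] by (intro mult_left_mono add_mono) auto
    finally have "norm (\<psi> x) \<le> 2 ^ ?n * (K + L) / (\<Prod>b\<in>Basis. 1 + (x \<bullet> b)\<^sup>2)"
      using pos by (simp add: pos_le_divide_eq)
    also have "\<dots> = 2 ^ ?n * (K + L) * ?g x" using prod_inversef[of "\<lambda>b. 1 + (x \<bullet> b)\<^sup>2" Basis] by (simp add: divide_inverse)
    finally show ?thesis by simp
  qed
  then show ?thesis
    by (intro Bochner_Integration.integrable_bound[of lborel "\<lambda>x. 2 ^ ?n * (K + L) * ?g x" \<psi>]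
        integrable_mult_right integrable_lborel_prod integrable_inverse_1_plus_square_lborel)
       (auto simp: schwartz_measurable[OF assms])
qed

text \<open>Both functions have the same integral against every Schwartz function, in particular
  against every Gaussian; \<open>is_fourier\<close> also supplies the integrability of these
  products. Real and imaginary parts are treated separately because the annihilation lemma is about
  real functions.\<close>

lemma is_fourier_unique_AE:
  fixes f :: "'a::euclidean_space \<Rightarrow> complex"
  assumes "is_fourier f g" "is_fourier f g'"
  shows "AE x in lborel. g x = g' x"
proof -
  have [measurable]: "g \<in> borel_measurable borel" "g' \<in> borel_measurable borel"
    using assms by (auto simp: is_fourier_def)
  let ?e = "\<lambda>a c x. exp (- c * (norm (x - a))\<^sup>2)"
  have *: "integrable lborel (\<lambda>x. (g x - g' x) * complex_of_real (?e a c x))"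
    "(\<integral>x. (g x - g' x) * complex_of_real (?e a c x) \<partial>lborel) = 0" if "c > 0" for a c
    using assms schwartz_gauss[OF that, of a] unfolding is_fourier_def by (simp_all add: left_diff_distrib)
  have "AE x in lborel. Re (g x - g' x) = 0"
  proof (rule AE_zero_if_gauss_integrals_zero)
    fix a :: 'a and c :: real assume "c > 0"
    note * = *[OF this, of a]
    show "integrable lborel (\<lambda>x. Re (g x - g' x) * ?e a c x)"
      using integrable_Re[OF *(1)] by simp
    show "(\<integral>x. Re (g x - g' x) * ?e a c x \<partial>lborel) = 0"
      using integral_Re[OF *(1)] *(2) by simp
  qed measurable
  moreover have "AE x in lborel. Im (g x - g' x) = 0"
  proof (rule AE_zero_if_gauss_integrals_zero)
    fix a :: 'a and c :: real assume "c > 0"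
    note * = *[OF this, of a]
    show "integrable lborel (\<lambda>x. Im (g x - g' x) * ?e a c x)"
      using integrable_Im[OF *(1)] by simp
    show "(\<integral>x. Im (g x - g' x) * ?e a c x \<partial>lborel) = 0"
      using integral_Im[OF *(1)] *(2) by simp
  qed measurable
  ultimately show ?thesis by eventually_elim (simp add: complex_eq_iff)
qed

section \<open>Gaussian regularization\<close>

text \<open>Meant for Jensen's inequality with \<open>I = UNIV\<close>, hence the absolute value. If
  an argument is 0, the claim is \<open>r powr p \<le> r\<close> on (0, 1); otherwise both absolute
  values are positive and \<open>powr_convex\<close> applies.\<close>

lemma convex_on_abs_powr:
  assumes "p \<ge> 1"
  shows "convex_on UNIV (\<lambda>x::real. \<bar>x\<bar> powr p)"
proof (rule convex_onI)
  fix t x y :: real assume t: "0 < t" "t < 1"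
  have scale: "\<bar>r * z\<bar> powr p \<le> r * \<bar>z\<bar> powr p" if "0 < r" "r < 1" for r z :: real
  proof -
    have "r powr p \<le> r powr 1" using that assms by (intro powr_mono') auto
    then show ?thesis using that by (simp add: abs_mult powr_mult mult_right_mono)
  qed
  show "\<bar>(1 - t) *\<^sub>R x + t *\<^sub>R y\<bar> powr p \<le> (1 - t) * \<bar>x\<bar> powr p + t * \<bar>y\<bar> powr p"
  proof (cases "x = 0 \<or> y = 0")
    case True
    then show ?thesis using scale[of t y] scale[of "1 - t" x] t assms by auto
  next
    case False
    have "\<bar>(1 - t) *\<^sub>R x + t *\<^sub>R y\<bar> \<le> (1 - t) * \<bar>x\<bar> + t * \<bar>y\<bar>"
      using t abs_triangle_ineq[of "(1 - t) * x" "t * y"] by (simp add: abs_mult)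
    then have "\<bar>(1 - t) *\<^sub>R x + t *\<^sub>R y\<bar> powr p \<le> ((1 - t) * \<bar>x\<bar> + t * \<bar>y\<bar>) powr p"
      using assms by (intro powr_mono2) auto
    also have "\<dots> \<le> (1 - t) * \<bar>x\<bar> powr p + t * \<bar>y\<bar> powr p"
      using convex_onD[OF powr_convex[OF assms], of t "\<bar>x\<bar>" "\<bar>y\<bar>"] t False by simp
    finally show ?thesis .
  qed
qed simp

definition gauss_smooth :: "real \<Rightarrow> ('a::euclidean_space \<Rightarrow> complex) \<Rightarrow> 'a \<Rightarrow> complex" where
  "gauss_smooth s u t = (\<integral>z. u z * complex_of_real (gauss_kernel s (t - z)) \<partial>lborel)"

lemma measurable_gauss_smooth [measurable]:
  assumes [measurable]: "u \<in> borel_measurable borel"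
  shows "gauss_smooth s u \<in> borel_measurable borel"
  unfolding gauss_smooth_def by measurable

lemma continuous_on_fourier_integral:
  "integrable lborel f \<Longrightarrow> continuous_on UNIV (fourier_integral f)"
  unfolding fourier_integral_altdef[abs_def]
  by (intro continuous_on_integral_fourier_character) auto

lemma measurable_fourier_integral [measurable]:
  "integrable lborel f \<Longrightarrow> fourier_integral f \<in> borel_measurable borel"
  by (intro borel_measurable_continuous_onI continuous_on_fourier_integral)

lemma norm_fourier_integral_le: "norm (fourier_integral f y) \<le> (\<integral>x. norm (f x) \<partial>lborel)"
  unfolding fourier_integral_altdef by (rule norm_integral_fourier_character_le)

text \<open>The multiplication formula: the classical transform of an integrable function is its
  distributional one.\<close>

lemma is_fourier_fourier_integral:
  fixes f :: "'a::euclidean_space \<Rightarrow> complex"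
  assumes f: "integrable lborel f"
  shows "is_fourier f (fourier_integral f)"
  unfolding is_fourier_def
proof (intro conjI allI impI)
  show "f \<in> borel_measurable borel" "fourier_integral f \<in> borel_measurable borel"
    using f by (auto intro: measurable_fourier_integral)
  fix \<psi> :: "'a \<Rightarrow> complex" assume "schwartz \<psi>"
  then have \<psi>: "integrable lborel \<psi>" by (rule schwartz_integrable)
  \<comment> \<open>Used in both directions: one factor is integrable, the other is a transform and
    hence bounded.\<close>
  have *: "integrable lborel (\<lambda>x. g x * fourier_integral k x)"
    if "integrable lborel g" "integrable lborel k" for g k :: "'a \<Rightarrow> complex"
    by (rule Bochner_Integration.integrable_bound[of _ "\<lambda>x. norm (g x) * (\<integral>x. norm (k x) \<partial>lborel)"])
       (use that in \<open>auto simp: norm_mult intro!: mult_left_mono norm_fourier_integral_le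
          order_trans[OF norm_fourier_integral_le abs_ge_self]\<close>)
  show "integrable lborel (\<lambda>x. f x * fourier_integral \<psi> x)" using f \<psi> by (rule *)
  show "integrable lborel (\<lambda>y. fourier_integral f y * \<psi> y)" using *[OF \<psi> f] by (simp add: mult.commute)
  show "(\<integral>y. fourier_integral f y * \<psi> y \<partial>lborel) = (\<integral>x. f x * fourier_integral \<psi> x \<partial>lborel)"
    using fourier_fubini[OF lborel.sigma_finite_measure_axioms lborel.sigma_finite_measure_axioms _ _ f \<psi>]
    unfolding fourier_integral_altdef by (simp add: mult.commute fourier_character_commute)
qed

lemma gauss_smooth_integrable:
  assumes "integrable lborel u" "s > 0"
  shows "integrable lborel (gauss_smooth s u)"
  using lborel_pair.integrable_snd[OF integrable_convolution[OF assms(1),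
      of "\<lambda>x. complex_of_real (gauss_kernel s x)"]] assms(2)
  unfolding gauss_smooth_def[abs_def] by (auto intro: integrable_gauss_kernel)

lemma fourier_integral_gauss_smooth:
  fixes u :: "'a::euclidean_space \<Rightarrow> complex"
  assumes u: "integrable lborel u" and s: "s > 0"
  shows "fourier_integral (gauss_smooth s u) y = fourier_integral u y * complex_of_real (gauss_hat s y)"
proof -
  have [measurable]: "u \<in> borel_measurable borel" using u by simp
  let ?G = "\<lambda>x. complex_of_real (gauss_kernel s x)"
  have "integrable lborel ?G" using integrable_gauss_kernel[OF s] by (rule integrable_of_real)
  note conv = integrable_convolution[OF u this]
  have int: "integrable (lborel \<Otimes>\<^sub>M lborel) (\<lambda>(z, t). fourier_character t y * (u z * ?G (t - z)))"
    by (rule Bochner_Integration.integrable_bound[OF conv]) (auto simp: norm_mult)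
  have inner: "(\<integral>t. fourier_character t y * ?G (t - z) \<partial>lborel)
      = fourier_character z y * complex_of_real (gauss_hat s y)" for z
  proof -
    have "(\<integral>t. fourier_character t y * ?G (t - z) \<partial>lborel)
        = (\<integral>t. fourier_character (t + z) y * ?G (t + z - z) \<partial>lborel)"
      by (rule lborel_integral_translate[symmetric]) measurable
    also have "\<dots> = (\<integral>t. fourier_character z y * (fourier_character t y * ?G t) \<partial>lborel)"
      by (simp add: fourier_character_add_left mult_ac)
    finally show ?thesis by (simp add: fourier_gauss_kernel[OF s])
  qed
  have "fourier_integral (gauss_smooth s u) y
      = (\<integral>t. (\<integral>z. fourier_character t y * (u z * ?G (t - z)) \<partial>lborel) \<partial>lborel)"
    unfolding fourier_integral_altdef gauss_smooth_def by simp
  also have "\<dots> = (\<integral>z. (\<integral>t. u z * (fourier_character t y * ?G (t - z)) \<partial>lborel) \<partial>lborel)"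
    using lborel_pair.Fubini_integral[OF int] by (simp only: prod.case mult.left_commute)
  also have "\<dots> = (\<integral>z. u z * (fourier_character z y * complex_of_real (gauss_hat s y)) \<partial>lborel)"
    by (simp only: integral_mult_right_zero inner)
  also have "\<dots> = (\<integral>z. fourier_character z y * u z * complex_of_real (gauss_hat s y) \<partial>lborel)"
    by (simp only: mult_ac)
  finally show ?thesis by (simp add: fourier_integral_altdef)
qed

lemma fourier_integral_times_gauss_hat_integrable:
  fixes u :: "'a::euclidean_space \<Rightarrow> complex"
  assumes u: "integrable lborel u" and s: "s > 0"
  shows "integrable lborel (\<lambda>y. fourier_integral u y * complex_of_real (gauss_hat s y))"
proof (rule Bochner_Integration.integrable_bound)
  show "integrable lborel (\<lambda>y. (\<integral>x. norm (u x) \<partial>lborel) * gauss_hat s y)"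
    using integrable_gauss_hat[OF s] by (rule integrable_mult_right)
  show "AE y in lborel. norm (fourier_integral u y * complex_of_real (gauss_hat s y))
      \<le> norm ((\<integral>x. norm (u x) \<partial>lborel) * gauss_hat s y)"
    by (intro AE_I2) (simp add: norm_mult mult_right_mono norm_fourier_integral_le)
qed (use measurable_fourier_integral[OF u] in measurable)

text \<open>Exchanging the integrals leaves the transform of a Gaussian at \<open>z + x\<close>, so
  inversion reduces to \<open>fourier_gauss_hat\<close>. Both transforms carry the same sign in the
  exponent, which is why the reflected point \<open>- x\<close> appears.\<close>

lemma fourier_integral_twice_gauss_smooth:
  fixes u :: "'a::euclidean_space \<Rightarrow> complex"
  assumes u: "integrable lborel u" and s: "s > 0"
  shows "fourier_integral (\<lambda>y. fourier_integral u y * complex_of_real (gauss_hat s y)) x = gauss_smooth s u (- x)"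
proof -
  let ?H = "\<lambda>y. complex_of_real (gauss_hat s y)"
  have g: "integrable lborel (\<lambda>y. fourier_character y x * ?H y)"
    using integrable_of_real[OF integrable_gauss_hat[OF s]]
    by (rule integrable_fourier_character_mult) simp
  have inner: "(\<integral>y. fourier_character z y * (fourier_character y x * ?H y) \<partial>lborel)
      = complex_of_real (gauss_kernel s (- x - z))" for z
  proof -
    have "(\<integral>y. fourier_character z y * (fourier_character y x * ?H y) \<partial>lborel)
        = (\<integral>y. fourier_character y (z + x) * ?H y \<partial>lborel)"
      by (simp add: fourier_character_commute[of _ x] fourier_character_commute[of _ "z + x"]
          fourier_character_add_left mult_ac)
    also have "\<dots> = complex_of_real (gauss_kernel s (z + x))" by (rule fourier_gauss_hat[OF s])
    also have "gauss_kernel s (z + x) = gauss_kernel s (- x - z)"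
      using gauss_kernel_uminus[of s "z + x"] by (simp only: minus_add add_uminus_conv_diff)
    finally show ?thesis .
  qed
  have "fourier_integral (\<lambda>y. fourier_integral u y * ?H y) x
      = (\<integral>y. (fourier_character y x * ?H y) * (\<integral>z. fourier_character z y * u z \<partial>lborel) \<partial>lborel)"
    unfolding fourier_integral_altdef by (simp add: mult_ac)
  also have "\<dots> = (\<integral>z. u z * (\<integral>y. fourier_character z y * (fourier_character y x * ?H y) \<partial>lborel) \<partial>lborel)"
    by (rule fourier_fubini) (use u g in \<open>auto intro: lborel.sigma_finite_measure_axioms\<close>)
  also have "\<dots> = gauss_smooth s u (- x)" by (simp only: inner gauss_smooth_def)
  finally show ?thesis .
qed

text \<open>\<open>gauss_smooth s u t\<close> is the mean of \<open>u\<close> under the probability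
  measure with density \<open>gauss_kernel s (t - z)\<close> in \<open>z\<close>; Jensen's
  inequality is applied to \<open>norm (u z)\<close> under it.\<close>

lemma gauss_smooth_powr_le:
  fixes u :: "'a::euclidean_space \<Rightarrow> complex"
  assumes u: "integrable lborel u" and fin: "(\<integral>\<^sup>+x. ennreal (norm (u x) powr p) \<partial>lborel) < \<infinity>"
    and p: "p \<ge> 1" and s: "s > 0"
  shows "ennreal (norm (gauss_smooth s u t) powr p)
    \<le> (\<integral>\<^sup>+z. ennreal (norm (u z) powr p * gauss_kernel s (t - z)) \<partial>lborel)"
proof -
  have [measurable]: "u \<in> borel_measurable borel" using u by simp
  let ?c = "(1 / sqrt (2 * pi * s\<^sup>2)) ^ DIM('a)"
  have G_le: "gauss_kernel s (t - z) \<le> ?c" for z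
  proof -
    have "gauss_kernel s (t - z) \<le> ?c * 1"
      unfolding gauss_kernel_eq by (intro mult_left_mono) auto
    then show ?thesis by simp
  qed
  \<comment> \<open>Jensen needs \<open>norm (u z)\<close> and its power integrable under this
    density. The kernel never exceeds its value \<open>?c\<close> at 0, so integrability for
    Lebesgue measure is enough.\<close>
  have intG: "integrable lborel (\<lambda>z. f z * gauss_kernel s (t - z))"
    if f: "integrable lborel f" for f :: "'a \<Rightarrow> real"
  proof (rule Bochner_Integration.integrable_bound)
    show "integrable lborel (\<lambda>z. f z * ?c)" using f by simp
    show "AE z in lborel. norm (f z * gauss_kernel s (t - z)) \<le> norm (f z * ?c)"
      using G_le s by (intro AE_I2) (auto simp: abs_mult intro!: mult_left_mono)
    show "(\<lambda>z. f z * gauss_kernel s (t - z)) \<in> borel_measurable lborel"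
      using borel_measurable_integrable[OF f] by measurable
  qed
  let ?M = "density lborel (\<lambda>z. ennreal (gauss_kernel s (t - z)))"
  have "emeasure ?M (space ?M) = (\<integral>\<^sup>+z. ennreal (gauss_kernel s (t - z)) \<partial>lborel)"
    by (simp add: emeasure_density)
  also have "\<dots> = (\<integral>\<^sup>+z. ennreal (gauss_kernel s (z::'a)) \<partial>lborel)"
    by (rule lborel_nn_integral_reflect) measurable
  also have "\<dots> = 1"
    using s by (subst nn_integral_eq_integral) (auto simp: integral_gauss_kernel integrable_gauss_kernel)
  finally interpret M: prob_space ?M by (rule prob_spaceI)
  have up: "integrable lborel (\<lambda>z. norm (u z) powr p)"
    using fin by (intro integrableI_bounded) auto
  have d: "integrable ?M f \<longleftrightarrow> integrable lborel (\<lambda>z. f z * gauss_kernel s (t - z))"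
    "integral\<^sup>L ?M f = (\<integral>z. f z * gauss_kernel s (t - z) \<partial>lborel)"
    if [measurable]: "f \<in> borel_measurable borel" for f :: "'a \<Rightarrow> real"
    by (simp_all add: integrable_density integral_density mult.commute)
  have "norm (gauss_smooth s u t) \<le> (\<integral>z. norm (u z) * gauss_kernel s (t - z) \<partial>lborel)"
    unfolding gauss_smooth_def by (rule order_trans[OF integral_norm_bound]) (simp add: norm_mult)
  then have "norm (gauss_smooth s u t) powr p \<le> \<bar>integral\<^sup>L ?M (\<lambda>z. norm (u z))\<bar> powr p"
    using p by (intro powr_mono2) (auto simp: d)
  also have "\<dots> \<le> integral\<^sup>L ?M (\<lambda>z. \<bar>norm (u z)\<bar> powr p)"
    using u up p by (intro M.jensens_inequality[where I=UNIV] convex_on_abs_powr) (auto simp: d intG)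
  also have "\<dots> = (\<integral>z. norm (u z) powr p * gauss_kernel s (t - z) \<partial>lborel)"
    by (simp add: d)
  finally have "ennreal (norm (gauss_smooth s u t) powr p)
      \<le> ennreal (\<integral>z. norm (u z) powr p * gauss_kernel s (t - z) \<partial>lborel)"
    by (rule ennreal_leI)
  also have "\<dots> = (\<integral>\<^sup>+z. ennreal (norm (u z) powr p * gauss_kernel s (t - z)) \<partial>lborel)"
    by (rule nn_integral_eq_integral[symmetric]) (auto intro: intG up)
  finally show ?thesis .
qed

text \<open>Integrate the pointwise bound over \<open>t\<close> and exchange the nonnegative
  integrals: the kernel has mass 1 in \<open>t\<close> too.\<close>

lemma nn_integral_gauss_smooth_powr_le:
  fixes u :: "'a::euclidean_space \<Rightarrow> complex"
  assumes u: "integrable lborel u" and fin: "(\<integral>\<^sup>+x. ennreal (norm (u x) powr p) \<partial>lborel) < \<infinity>"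
    and p: "p \<ge> 1" and s: "s > 0"
  shows "(\<integral>\<^sup>+t. ennreal (norm (gauss_smooth s u t) powr p) \<partial>lborel)
    \<le> (\<integral>\<^sup>+x. ennreal (norm (u x) powr p) \<partial>lborel)"
proof -
  have [measurable]: "u \<in> borel_measurable borel" using u by simp
  have one: "(\<integral>\<^sup>+t. ennreal (gauss_kernel s (t - z)) \<partial>lborel) = 1" for z :: 'a
    using lborel_nn_integral_translate[of "\<lambda>t. ennreal (gauss_kernel s t)" z] s
    by (simp add: nn_integral_eq_integral integral_gauss_kernel integrable_gauss_kernel)
  have "(\<integral>\<^sup>+t. ennreal (norm (gauss_smooth s u t) powr p) \<partial>lborel)
    \<le> (\<integral>\<^sup>+t. (\<integral>\<^sup>+z. ennreal (norm (u z) powr p * gauss_kernel s (t - z)) \<partial>lborel) \<partial>lborel)"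
    by (intro nn_integral_mono gauss_smooth_powr_le assms)
  also have "\<dots> = (\<integral>\<^sup>+z. (\<integral>\<^sup>+t. ennreal (norm (u z) powr p * gauss_kernel s (t - z)) \<partial>lborel) \<partial>lborel)"
    by (rule lborel_pair.Fubini') measurable
  also have "\<dots> = (\<integral>\<^sup>+z. ennreal (norm (u z) powr p) \<partial>lborel)"
    by (simp add: ennreal_mult nn_integral_cmult one)
  finally show ?thesis .
qed

text \<open>Makes \<open>precise_for\<close> automatic for the continuous test functions, wherever
  the variations of \<mu> sit.\<close>

lemma averages_converge_continuous:
  fixes h :: "'a::euclidean_space \<Rightarrow> complex"
  assumes "continuous_on UNIV h"
  shows "averages_converge h x"
  unfolding averages_converge_def
proof (rule tendstoI)
  fix e :: real assume e: "e > 0"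
  obtain d where d: "d > 0" "\<And>z. dist z x < d \<Longrightarrow> dist (h z) (h x) < e / 2"
    using assms e unfolding continuous_on_iff by (metis UNIV_I half_gt_zero)
  have "dist ((LINT z:ball x r|lborel. h z) /\<^sub>R measure lborel (ball x r)) (h x) < e"
    if r: "0 < r" "r < d" for r
  proof -
    let ?V = "measure lborel (ball x r)"
    have V: "?V > 0" using r by (simp add: content_ball_pos)
    have fin: "emeasure lborel (ball x r) \<noteq> \<infinity>" using emeasure_lborel_ball_finite[of x r] by simp
    have int: "set_integrable lborel (ball x r) f" if "continuous_on UNIV f" for f :: "'a \<Rightarrow> 'b::{banach, second_countable_topology}"
      using set_integrable_subset[of lborel "cball x r" f "ball x r"]
        borel_integrable_compact[of "cball x r" f] continuous_on_subset[OF that]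
      by (auto simp: set_integrable_def ball_subset_cball)
    have "(LINT z:ball x r|lborel. h z) /\<^sub>R ?V - h x = (LINT z:ball x r|lborel. h z - h x) /\<^sub>R ?V"
      using V fin by (subst set_integral_diff) (auto simp: set_integral_const int assms scaleR_diff_right)
    also have "norm \<dots> \<le> (LINT z:ball x r|lborel. norm (h z - h x)) / ?V"
    proof -
      have "norm (LINT z:ball x r|lborel. h z - h x) \<le> (LINT z:ball x r|lborel. norm (h z - h x))"
        by (intro set_integral_norm_bound int continuous_intros assms)
      then show ?thesis using V by (simp add: divide_inverse mult.commute mult_right_mono)
    qed
    also have "\<dots> \<le> (LINT z:ball x r|lborel. e / 2) / ?V"
      using V fin d(2) r
      by (intro divide_right_mono set_integral_mono int continuous_intros assms)
         (auto simp: dist_norm[symmetric] dist_commute intro!: less_imp_le)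
    also have "\<dots> = e / 2" using V fin by (simp add: set_integral_const)
    finally show ?thesis using e by (simp add: dist_norm)
  qed
  then show "\<forall>\<^sub>F r in at_right 0. dist ((LINT z:ball x r|lborel. h z) /\<^sub>R measure lborel (ball x r)) (h x) < e"
    using d(1) by (auto simp: eventually_at_right_field)
qed

section \<open>Bounds from the dual norm\<close>

lemma conj_exponent_1: "conj_exponent 1 = \<infinity>"
  and conj_exponent_infinity: "conj_exponent \<infinity> = 1"
  by (simp_all add: conj_exponent_def)

lemma conj_exponent_ennreal:
  assumes "r > 1"
  shows "conj_exponent (ennreal r) = ennreal (r / (r - 1))"
proof -
  have "1 - ennreal (1 / r) = ennreal (1 - 1 / r)"
    using assms by (subst ennreal_1[symmetric], subst ennreal_minus) auto
  moreover have "inverse (1 - 1 / r) = r / (r - 1)" "1 - 1 / r > 0"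
    using assms by (auto simp: field_simps)
  ultimately show ?thesis
    using assms by (simp add: conj_exponent_def inverse_ennreal inverse_eq_divide)
qed

lemma conj_exponent_conj_exponent:
  assumes "1 \<le> r"
  shows "conj_exponent (conj_exponent (ennreal r)) = ennreal r"
proof (cases "r = 1")
  case True
  then show ?thesis using conj_exponent_1 conj_exponent_infinity by simp
next
  case False
  then have r: "r > 1" using assms by simp
  then have "r / (r - 1) > 1" by (simp add: field_simps)
  moreover have "r / (r - 1) / (r / (r - 1) - 1) = r" using r by (simp add: field_simps)
  ultimately show ?thesis using r by (simp add: conj_exponent_ennreal)
qed

lemma one_le_conj_exponent:
  assumes "1 \<le> r"
  shows "1 \<le> conj_exponent (ennreal r)"
proof (cases "r = 1")
  case True
  then show ?thesis using conj_exponent_1 by simp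
next
  case False
  then have r: "r > 1" using assms by simp
  then have "ennreal 1 \<le> ennreal (r / (r - 1))" by (intro ennreal_leI) (simp add: field_simps)
  then show ?thesis using r by (simp add: conj_exponent_ennreal)
qed

text \<open>Removes the root and the detour through \<open>enn2real\<close> from
  \<open>Lp_norm\<close>, so that later estimates deal with power integrals in
  \<open>ennreal\<close>.\<close>

lemma Lp_norm_ennreal_le_iff:
  assumes "r > 0" "c \<ge> 0"
  shows "Lp_norm (ennreal r) f \<le> ennreal c
    \<longleftrightarrow> (\<integral>\<^sup>+ x. ennreal (norm (f x) powr r) \<partial>lborel) \<le> ennreal (c powr r)"
proof (cases "\<integral>\<^sup>+ x. ennreal (norm (f x) powr r) \<partial>lborel")
  case top
  then show ?thesis using assms by (simp add: Lp_norm_def Let_def top_unique)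
next
  case (real i)
  have "i powr (1 / r) \<le> c \<longleftrightarrow> i \<le> c powr r"
  proof
    assume "i powr (1 / r) \<le> c"
    then have "(i powr (1 / r)) powr r \<le> c powr r" using assms by (intro powr_mono2) auto
    then show "i \<le> c powr r" using assms real by (simp add: powr_powr)
  next
    assume "i \<le> c powr r"
    then have "i powr (1 / r) \<le> (c powr r) powr (1 / r)" using assms real by (intro powr_mono2) auto
    then show "i powr (1 / r) \<le> c" using assms by (simp add: powr_powr)
  qed
  then show ?thesis using assms real by (simp add: Lp_norm_def Let_def)
qed

text \<open>Interpolation between the integral and the supremum: for a finite exponent
  \<open>t\<close>, all but one power of \<open>norm (f x)\<close> is absorbed into
  \<open>B powr (t - 1)\<close>.\<close>

lemma bounded_integrable_in_Lp:
  fixes f :: "'a::euclidean_space \<Rightarrow> complex"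
  assumes f: "integrable lborel f" and B: "\<And>x. norm (f x) \<le> B" and q: "1 \<le> q"
  shows "f \<in> Lp q"
proof -
  have [measurable]: "f \<in> borel_measurable borel" using f by simp
  have "Lp_norm q f < \<infinity>"
  proof (cases q)
    case top
    have "esssup lborel (\<lambda>x. ennreal (norm (f x))) \<le> ennreal B"
      by (intro esssup_I) (auto intro: ennreal_leI B)
    also have "\<dots> < \<infinity>" by simp
    finally show ?thesis using top by (simp add: Lp_norm_def)
  next
    case (real t)
    then have t: "t \<ge> 1" using q by (metis ennreal_1 ennreal_le_iff)
    have "norm (f x) powr t \<le> B powr (t - 1) * norm (f x)" for x
    proof -
      have "norm (f x) powr t = norm (f x) powr (t - 1) * norm (f x) powr 1"
        by (simp only: powr_add[symmetric]) simp
      also have "\<dots> \<le> B powr (t - 1) * norm (f x)"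
        using B t by (auto intro!: mult_right_mono powr_mono2)
      finally show ?thesis .
    qed
    then have "(\<integral>\<^sup>+ x. ennreal (norm (f x) powr t) \<partial>lborel) \<le> (\<integral>\<^sup>+ x. ennreal (B powr (t - 1) * norm (f x)) \<partial>lborel)"
      by (intro nn_integral_mono ennreal_leI)
    also have "\<dots> = ennreal (B powr (t - 1)) * (\<integral>\<^sup>+ x. ennreal (norm (f x)) \<partial>lborel)"
      by (simp add: ennreal_mult nn_integral_cmult)
    also have "\<dots> < \<infinity>"
      using f by (auto simp: integrable_iff_bounded ennreal_mult_less_top)
    finally show ?thesis using real t by (simp add: Lp_norm_def Let_def)
  qed
  then show ?thesis by (simp add: Lp_def)
qed

text \<open>Two transforms are involved. That \<open>h s\<close> is the transform of the smoothed
  \<open>u\<close> puts it into \<open>hat_Lp\<close>; that its own transform is the reflected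
  smoothed function bounds \<open>hat_Lp_norm\<close>, which measures
  \<open>fourier (h s)\<close>.\<close>

lemma gauss_regularized_transform_in_unit_ball:
  fixes u :: "'a::euclidean_space \<Rightarrow> complex"
  defines "h \<equiv> \<lambda>s y. fourier_integral u y * complex_of_real (gauss_hat s y)"
  assumes u: "integrable lborel u" and le1: "(\<integral>\<^sup>+x. ennreal (norm (u x) powr r) \<partial>lborel) \<le> 1"
    and r: "1 \<le> r" and s: "s > 0"
  shows "h s \<in> hat_Lp (conj_exponent (ennreal r))"
    and "hat_Lp_norm (conj_exponent (ennreal r)) (h s) \<le> 1"
proof -
  have [measurable]: "u \<in> borel_measurable borel" using u by simp
  let ?\<phi> = "gauss_smooth s u"
  have \<phi>: "integrable lborel ?\<phi>" using u s by (rule gauss_smooth_integrable)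
  have "(\<integral>\<^sup>+x. ennreal (norm (?\<phi> x) powr r) \<partial>lborel) \<le> (\<integral>\<^sup>+x. ennreal (norm (u x) powr r) \<partial>lborel)"
    using le1 by (intro nn_integral_gauss_smooth_powr_le u r s) (simp add: le_less_trans[OF le1])
  then have \<phi>1: "(\<integral>\<^sup>+x. ennreal (norm (?\<phi> x) powr r) \<partial>lborel) \<le> 1" using le1 by (rule order_trans)
  have h: "h s = fourier_integral ?\<phi>"
    by (simp add: h_def fun_eq_iff fourier_integral_gauss_smooth[OF u s])
  have hint: "integrable lborel (h s)"
    unfolding h_def by (rule fourier_integral_times_gauss_hat_integrable[OF u s])
  have norm_le1: "Lp_norm (ennreal r) f \<le> 1" if "(\<integral>\<^sup>+x. ennreal (norm (f x) powr r) \<partial>lborel) \<le> 1"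
    for f :: "'a \<Rightarrow> complex"
    using Lp_norm_ennreal_le_iff[of r 1 f] r that by simp
  have "?\<phi> \<in> Lp (ennreal r)"
    using norm_le1[OF \<phi>1] by (auto simp: Lp_def intro: le_less_trans)
  moreover have "is_fourier ?\<phi> (h s)" unfolding h by (rule is_fourier_fourier_integral[OF \<phi>])
  moreover have "h s \<in> Lp (conj_exponent (ennreal r))"
    using hint norm_fourier_integral_le[of ?\<phi>] one_le_conj_exponent[OF r]
    unfolding h by (rule bounded_integrable_in_Lp)
  ultimately show "h s \<in> hat_Lp (conj_exponent (ennreal r))"
    unfolding hat_Lp_def conj_exponent_conj_exponent[OF r] by blast
  have F: "is_fourier (h s) (\<lambda>x. ?\<phi> (- x))"
    using is_fourier_fourier_integral[OF hint]
    unfolding h_def fourier_integral_twice_gauss_smooth[OF u s, abs_def] .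
  \<comment> \<open>The choice in \<open>fourier\<close> returns some transform because
    \<open>F\<close> exhibits one; uniqueness then identifies it almost everywhere, and the
    reflection preserves the norm.\<close>
  then have "is_fourier (h s) (fourier (h s))"
    unfolding fourier_def by (rule someI[of "is_fourier (h s)"])
  then have "AE x in lborel. fourier (h s) x = ?\<phi> (- x)" using F by (rule is_fourier_unique_AE)
  then have "(\<integral>\<^sup>+x. ennreal (norm (fourier (h s) x) powr r) \<partial>lborel)
      = (\<integral>\<^sup>+x. ennreal (norm (?\<phi> (0 - x)) powr r) \<partial>lborel)"
    by (intro nn_integral_cong_AE) (auto elim: eventually_mono)
  also have "\<dots> = (\<integral>\<^sup>+x. ennreal (norm (?\<phi> x) powr r) \<partial>lborel)"
    by (rule lborel_nn_integral_reflect) measurable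
  finally show "hat_Lp_norm (conj_exponent (ennreal r)) (h s) \<le> 1"
    unfolding hat_Lp_norm_def conj_exponent_conj_exponent[OF r] using \<phi>1 by (intro norm_le1) simp
qed

section \<open>Integration against a finite complex measure\<close>

lemma cm_integrable_bounded:
  fixes h :: "'a::euclidean_space \<Rightarrow> complex"
  assumes "finite_complex_measure \<mu>" and [measurable]: "h \<in> borel_measurable borel"
    and "\<And>x. norm (h x) \<le> B"
  shows "cm_integrable \<mu> h"
  unfolding cm_integrable_def
proof
  fix M assume "M \<in> {Re_pos \<mu>, Re_neg \<mu>, Im_pos \<mu>, Im_neg \<mu>}"
  note M [measurable_cong] = finite_measure_variations[OF assms(1) this]
  show "integrable M h"
    using assms(3) by (intro finite_measure.integrable_const_bound[OF M(1), of _ B]) auto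
qed

lemma tendsto_cm_integral:
  fixes h :: "nat \<Rightarrow> 'a::euclidean_space \<Rightarrow> complex"
  assumes "finite_complex_measure \<mu>"
    and [measurable]: "\<And>k. h k \<in> borel_measurable borel" "g \<in> borel_measurable borel"
    and B: "\<And>k x. norm (h k x) \<le> B" and lim: "\<And>x. (\<lambda>k. h k x) \<longlonglongrightarrow> g x"
  shows "(\<lambda>k. cm_integral \<mu> (h k)) \<longlonglongrightarrow> cm_integral \<mu> g"
proof -
  have *: "(\<lambda>k. \<integral>x. h k x \<partial>M) \<longlonglongrightarrow> (\<integral>x. g x \<partial>M)"
    if "M \<in> {Re_pos \<mu>, Re_neg \<mu>, Im_pos \<mu>, Im_neg \<mu>}" for M
  proof -
    note M [measurable_cong] = finite_measure_variations[OF assms(1) that]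
    show ?thesis
      by (rule integral_dominated_convergence[where w = "\<lambda>_. B"])
         (use B lim finite_measure.integrable_const[OF M(1)] in auto)
  qed
  show ?thesis unfolding cm_integral_def by (intro tendsto_intros *) auto
qed

text \<open>The dual norm is applied to the damped functions \<open>h k\<close>, with a bound
  \<open>C\<close> independent of \<open>k\<close>. They are dominated by the L^1 norm of
  \<open>u\<close>, a constant and so integrable for the finite variations; hence the bound passes
  to the limit.\<close>

lemma norm_cm_integral_fourier_integral_le:
  fixes u :: "'a::euclidean_space \<Rightarrow> complex"
  assumes \<mu>: "finite_complex_measure \<mu>" and C: "star_norm (ennreal r) \<mu> \<le> ennreal C" "C \<ge> 0"
    and u: "integrable lborel u" and le1: "(\<integral>\<^sup>+x. ennreal (norm (u x) powr r) \<partial>lborel) \<le> 1"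
    and r: "1 \<le> r"
  shows "norm (cm_integral \<mu> (fourier_integral u)) \<le> C"
proof -
  note [measurable] = measurable_fourier_integral[OF u]
  define s where "s k = 1 / real (Suc k)" for k
  have s: "s k > 0" "s \<longlonglongrightarrow> 0" for k
    unfolding s_def using LIMSEQ_inverse_real_of_nat by (simp_all add: inverse_eq_divide)
  define h where "h k y = fourier_integral u y * complex_of_real (gauss_hat (s k) y)" for k y
  have [measurable]: "h k \<in> borel_measurable borel" for k unfolding h_def by measurable
  have bound: "norm (h k y) \<le> (\<integral>x. norm (u x) \<partial>lborel)" for k y
  proof -
    have "norm (h k y) \<le> norm (fourier_integral u y) * 1"
      unfolding h_def norm_mult by (intro mult_left_mono) auto
    then show ?thesis using norm_fourier_integral_le[of u y] by simp
  qed
  have "norm (cm_integral \<mu> (h k)) \<le> C" for k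
  proof -
    have "continuous_on UNIV (h k)"
      unfolding h_def gauss_hat_def
      by (intro continuous_intros continuous_on_fourier_integral u)
    then have "precise_for \<mu> (h k)"
      unfolding precise_for_def by (auto intro: averages_converge_continuous)
    moreover have "cm_integrable \<mu> (h k)" by (rule cm_integrable_bounded[OF \<mu> _ bound]) measurable
    ultimately have "ennreal (norm (cm_integral \<mu> (h k))) \<le> star_norm (ennreal r) \<mu>"
      unfolding star_norm_def
      using gauss_regularized_transform_in_unit_ball[OF u le1 r s(1)[of k]]
      by (intro SUP_upper) (auto simp: h_def[abs_def])
    then have "ennreal (norm (cm_integral \<mu> (h k))) \<le> ennreal C" using C(1) by (rule order_trans)
    then show ?thesis using C(2) by simp
  qed
  moreover have "(\<lambda>k. cm_integral \<mu> (h k)) \<longlonglongrightarrow> cm_integral \<mu> (fourier_integral u)"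
  proof (rule tendsto_cm_integral[OF \<mu> _ _ bound])
    show "(\<lambda>k. h k x) \<longlonglongrightarrow> fourier_integral u x" for x
    proof -
      have "(\<lambda>k. h k x) \<longlonglongrightarrow> fourier_integral u x * complex_of_real (exp (- 2 * pi\<^sup>2 * 0\<^sup>2 * (norm x)\<^sup>2))"
        unfolding h_def gauss_hat_def by (intro tendsto_intros s)
      then show ?thesis by simp
    qed
  qed measurable
  ultimately show ?thesis
    by (intro tendsto_upperbound[OF tendsto_norm]) auto
qed

lemma fourier_measure_altdef: "fourier_measure \<mu> y = cm_integral \<mu> (\<lambda>x. fourier_character x y)"
  by (simp add: fourier_measure_def fourier_character_def)

lemma continuous_on_fourier_measure:
  fixes \<mu> :: "'a::euclidean_space set \<Rightarrow> complex"
  assumes "finite_complex_measure \<mu>"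
  shows "continuous_on UNIV (fourier_measure \<mu>)"
proof -
  have *: "continuous_on UNIV (\<lambda>y. \<integral>x. fourier_character x y \<partial>M)"
    if "M \<in> {Re_pos \<mu>, Re_neg \<mu>, Im_pos \<mu>, Im_neg \<mu>}" for M
  proof -
    note M = finite_measure_variations[OF assms that]
    show ?thesis
      using continuous_on_integral_fourier_character[OF M(2) finite_measure.integrable_const[OF M(1), of 1]]
      by simp
  qed
  show ?thesis
    unfolding fourier_measure_altdef[abs_def] cm_integral_def by (intro continuous_intros *) auto
qed

text \<open>An a priori bound by total masses, unrelated to the dual norm; it makes truncated powers
  of the transform integrable in the duality argument.\<close>

lemma fourier_measure_bounded:
  obtains K where "\<And>y. norm (fourier_measure \<mu> y) \<le> K"
proof
  fix y
  let ?m = "\<lambda>M. measure M (space M)"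
  have *: "norm (\<integral>x. fourier_character x y \<partial>M) \<le> ?m M" for M :: "'a measure"
    using norm_integral_fourier_character_le[where h = "\<lambda>x. x" and y = y and f = "\<lambda>_. 1" and M = M] by simp
  show "norm (fourier_measure \<mu> y) \<le> ?m (Re_pos \<mu>) + ?m (Re_neg \<mu>) + (?m (Im_pos \<mu>) + ?m (Im_neg \<mu>))"
    unfolding fourier_measure_altdef cm_integral_def
    by (intro order_trans[OF norm_triangle_ineq] add_mono)
       (auto simp: norm_mult intro!: order_trans[OF norm_triangle_ineq4] add_mono *)
qed

text \<open>Fubini for each variation separately. The integrability half of \<open>*\<close>
  justifies splitting the Lebesgue integral into four.\<close>

lemma integral_mult_fourier_measure:
  fixes u :: "'a::euclidean_space \<Rightarrow> complex"
  assumes \<mu>: "finite_complex_measure \<mu>" and u: "integrable lborel u"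
  shows "(\<integral>x. u x * fourier_measure \<mu> x \<partial>lborel) = cm_integral \<mu> (fourier_integral u)"
proof -
  have *: "(\<integral>y. fourier_integral u y \<partial>M) = (\<integral>x. u x * (\<integral>y. fourier_character y x \<partial>M) \<partial>lborel)"
    "integrable lborel (\<lambda>x. u x * (\<integral>y. fourier_character y x \<partial>M))"
    if "M \<in> {Re_pos \<mu>, Re_neg \<mu>, Im_pos \<mu>, Im_neg \<mu>}" for M
  proof -
    note M [measurable_cong] = finite_measure_variations[OF \<mu> that]
    interpret M: finite_measure M by fact
    show "(\<integral>y. fourier_integral u y \<partial>M) = (\<integral>x. u x * (\<integral>y. fourier_character y x \<partial>M) \<partial>lborel)"
      using fourier_fubini[OF lborel.sigma_finite_measure_axioms M.sigma_finite_measure_axioms _ M(2) u M.integrable_const[of 1]]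
      by (simp add: fourier_integral_altdef fourier_character_commute)
    have "norm (\<integral>y. fourier_character y x \<partial>M) \<le> measure M UNIV" for x
      using norm_integral_fourier_character_le[where h = "\<lambda>x. x" and y = x and f = "\<lambda>_. 1" and M = M] sets_eq_imp_space_eq[OF M(2)] by simp
    then have "norm (u x * (\<integral>y. fourier_character y x \<partial>M)) \<le> norm (norm (u x) * measure M UNIV)" for x
      by (simp add: norm_mult mult_left_mono)
    then have "AE x in lborel. norm (u x * (\<integral>y. fourier_character y x \<partial>M)) \<le> norm (norm (u x) * measure M UNIV)"
      by (rule AE_I2)
    moreover have "(\<lambda>x. u x * (\<integral>y. fourier_character y x \<partial>M)) \<in> borel_measurable lborel"
      using borel_measurable_integrable[OF u] by measurable
    moreover have "integrable lborel (\<lambda>x. norm (u x) * measure M UNIV)" using u by simp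
    ultimately show "integrable lborel (\<lambda>x. u x * (\<integral>y. fourier_character y x \<partial>M))"
      using Bochner_Integration.integrable_bound by blast
  qed
  let ?I = "\<lambda>M x. u x * (\<integral>y. fourier_character y x \<partial>M)"
  have "(\<integral>x. u x * fourier_measure \<mu> x \<partial>lborel)
    = (\<integral>x. (?I (Re_pos \<mu>) x - ?I (Re_neg \<mu>) x) + \<i> * (?I (Im_pos \<mu>) x - ?I (Im_neg \<mu>) x) \<partial>lborel)"
  proof -
    have "c * ((A - B) + \<i> * (D - E)) = (c * A - c * B) + \<i> * (c * D - c * E)" for c A B D E
      by (simp add: algebra_simps)
    then show ?thesis unfolding fourier_measure_altdef cm_integral_def by simp
  qed
  also have "\<dots> = cm_integral \<mu> (fourier_integral u)"
  proof -
    have "integrable lborel (?I M)" "(\<integral>x. ?I M x \<partial>lborel) = (\<integral>y. fourier_integral u y \<partial>M)"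
      if "M \<in> {Re_pos \<mu>, Re_neg \<mu>, Im_pos \<mu>, Im_neg \<mu>}" for M
      by (rule *(2)[OF that], rule *(1)[OF that, symmetric])
    note this[of "Re_pos \<mu>", simplified] this[of "Re_neg \<mu>", simplified]
      this[of "Im_pos \<mu>", simplified] this[of "Im_neg \<mu>", simplified]
    then show ?thesis by (simp add: cm_integral_def)
  qed
  finally show ?thesis .
qed

section \<open>Duality\<close>

text \<open>The free weight lets one extremal argument serve all exponents: \<open>w\<close> will be
  an indicator for \<open>r = 1\<close> and a truncated power of \<open>norm (m x)\<close> for
  \<open>r > 1\<close>. Bounds and bounded support make \<open>w\<close> and its powers
  integrable.\<close>

lemma weighted_integral_le_if_dual_bound:
  fixes m :: "'a::euclidean_space \<Rightarrow> complex" and w :: "'a \<Rightarrow> real"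
  assumes [measurable]: "m \<in> borel_measurable borel" "w \<in> borel_measurable borel"
    and C: "C \<ge> 0" and r: "r \<ge> 1"
    and dual: "\<And>u. integrable lborel u \<Longrightarrow> (\<integral>\<^sup>+x. ennreal (norm (u x) powr r) \<partial>lborel) \<le> 1
      \<Longrightarrow> norm (\<integral>x. u x * m x \<partial>lborel) \<le> C"
    and w: "\<And>x. 0 \<le> w x" "\<And>x. w x \<le> B" "\<And>x. x \<notin> ball 0 R \<Longrightarrow> w x = 0"
  shows "(\<integral>x. w x * norm (m x) \<partial>lborel) \<le> C * (\<integral>x. w x powr r \<partial>lborel) powr (1 / r)"
proof -
  have int: "integrable lborel f" if [measurable]: "f \<in> borel_measurable borel"
    and "\<And>x. \<bar>f x\<bar> \<le> D" "\<And>x. x \<notin> ball 0 R \<Longrightarrow> f x = 0" for f :: "'a \<Rightarrow> real" and D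
  proof (rule Bochner_Integration.integrable_bound)
    show "integrable lborel (\<lambda>x. D * indicator (ball 0 R :: 'a set) x)"
      using emeasure_lborel_ball_finite[of "0::'a" R]
      by (intro integrable_mult_right integrable_real_indicator) auto
    show "AE x in lborel. norm (f x) \<le> norm (D * indicator (ball 0 R) x)"
    proof (intro AE_I2)
      fix x
      show "norm (f x) \<le> norm (D * indicator (ball 0 R) x)"
        using that(2)[of x] that(3)[of x] by (cases "x \<in> ball 0 R") auto
    qed
  qed measurable
  have wint: "integrable lborel w" using w by (intro int[of _ B]) auto
  have wrint: "integrable lborel (\<lambda>x. w x powr r)"
    using w r by (intro int[of _ "B powr r"]) (auto intro!: powr_mono2)
  define J where "J = (\<integral>x. w x powr r \<partial>lborel)"
  have "J \<ge> 0" unfolding J_def by (intro integral_nonneg_AE) auto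
  show ?thesis
  \<comment> \<open>If \<open>J = 0\<close> no normalization is possible, but then \<open>w\<close>
    vanishes almost everywhere and the left side is 0.\<close>
  proof (cases "J = 0")
    case True
    then have "AE x in lborel. w x powr r = 0"
      unfolding J_def by (subst (asm) integral_nonneg_eq_0_iff_AE[OF wrint]) auto
    then have "AE x in lborel. w x * norm (m x) = 0" by eventually_elim auto
    then have "(\<integral>x. w x * norm (m x) \<partial>lborel) = 0" by (rule integral_eq_zero_AE)
    then show ?thesis using C by simp
  next
    case False
    define N where "N = J powr (1 / r)"
    have J: "J > 0" using False \<open>J \<ge> 0\<close> by simp
    then have N: "N > 0" by (simp add: N_def)
    have Nr: "N powr r = J" using J r by (simp add: N_def powr_powr)
    \<comment> \<open>The conjugate phase cancels that of \<open>m\<close>, and \<open>N\<close>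
      normalizes in L^r. Where \<open>m\<close> vanishes \<open>sgn\<close> is 0, which is
      consistent with \<open>w x * norm (m x) = 0\<close> there.\<close>
    define u where "u x = complex_of_real (w x / N) * cnj (sgn (m x))" for x
    have [measurable]: "cnj \<in> borel_measurable borel"
      by (intro borel_measurable_continuous_onI continuous_intros)
    have [measurable]: "u \<in> borel_measurable borel" unfolding u_def sgn_div_norm by measurable
    have un: "norm (u x) \<le> w x / N" for x
      using w(1)[of x] N by (auto simp: u_def norm_mult norm_divide norm_sgn)
    have uint: "integrable lborel u"
      by (rule Bochner_Integration.integrable_bound[of lborel "\<lambda>x. w x / N"])
         (use wint un w(1) N in auto)
    have "(\<integral>\<^sup>+x. ennreal (norm (u x) powr r) \<partial>lborel) \<le> (\<integral>\<^sup>+x. ennreal (w x powr r / J) \<partial>lborel)"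
    proof (intro nn_integral_mono ennreal_leI)
      fix x
      have "norm (u x) powr r \<le> (w x / N) powr r" using r un by (intro powr_mono2) auto
      also have "\<dots> = w x powr r / J" using w(1)[of x] N by (simp add: powr_divide Nr)
      finally show "norm (u x) powr r \<le> w x powr r / J" .
    qed
    also have "\<dots> = ennreal (\<integral>x. w x powr r / J \<partial>lborel)"
      using wrint J by (intro nn_integral_eq_integral) auto
    also have "\<dots> = 1" using J by (simp add: J_def)
    finally have "norm (\<integral>x. u x * m x \<partial>lborel) \<le> C" by (rule dual[OF uint])
    moreover have "u x * m x = complex_of_real (w x * norm (m x) / N)" for x
    proof -
      have "cnj (sgn (m x)) * m x = complex_of_real (norm (m x))"
        by (cases "m x = 0")
           (auto simp: sgn_div_norm scaleR_conv_of_real mult.commute[of "cnj _"]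
             complex_norm_square[symmetric] power2_eq_square field_simps)
      then show ?thesis by (simp add: u_def)
    qed
    ultimately have "norm (complex_of_real (\<integral>x. w x * norm (m x) / N \<partial>lborel)) \<le> C"
      by (simp del: of_real_mult of_real_divide integral_divide_zero)
    then have "(\<integral>x. w x * norm (m x) / N \<partial>lborel) \<le> C"
      unfolding norm_of_real by (rule order_trans[OF abs_ge_self])
    then have "(\<integral>x. w x * norm (m x) \<partial>lborel) / N \<le> C" by simp
    then show ?thesis using N unfolding N_def J_def[symmetric] by (simp add: field_simps)
  qed
qed

text \<open>The converse of Hoelder's inequality, with test functions restricted to integrable
  ones.\<close>

lemma Lp_norm_conj_exponent_le_if_dual_bound:
  fixes m :: "'a::euclidean_space \<Rightarrow> complex"
  assumes [measurable]: "m \<in> borel_measurable borel" and K: "\<And>x. norm (m x) \<le> K"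
    and C: "C \<ge> 0" and r: "r \<ge> 1"
    and dual: "\<And>u. integrable lborel u \<Longrightarrow> (\<integral>\<^sup>+x. ennreal (norm (u x) powr r) \<partial>lborel) \<le> 1
      \<Longrightarrow> norm (\<integral>x. u x * m x \<partial>lborel) \<le> C"
  shows "Lp_norm (conj_exponent (ennreal r)) m \<le> ennreal C"
proof (cases "r = 1")
  case True
  \<comment> \<open>The conjugate exponent is infinite. Testing with the part \<open>E\<close> of a
    ball where \<open>norm (m x) > C\<close> shows that the excess over \<open>C\<close> has
    integral at most 0 on \<open>E\<close>, although it is positive there; so \<open>E\<close> is
    null. Balls keep its measure finite, and countably many exhaust the space.\<close>
  have "AE x in lborel. \<not> (norm x < real R \<and> C < norm (m x))" for R :: nat
  proof -
    define E where "E = {x \<in> ball 0 (real R). C < norm (m x)}"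
    have [measurable]: "E \<in> sets borel" unfolding E_def by measurable
    have "emeasure lborel E \<le> emeasure lborel (ball 0 (real R) :: 'a set)"
      by (intro emeasure_mono) (auto simp: E_def)
    then have fin: "emeasure lborel E < \<infinity>"
      using emeasure_lborel_ball_finite[of "0::'a" "real R"] by (rule le_less_trans)
    have intE: "integrable lborel (indicator E :: 'a \<Rightarrow> real)"
      using fin by (intro integrable_real_indicator) auto
    have intm: "integrable lborel (\<lambda>x. indicator E x * norm (m x))"
      by (rule Bochner_Integration.integrable_bound[OF integrable_mult_right[OF intE, of K]])
         (auto simp: indicator_def intro: order_trans[OF K abs_ge_self])
    have "(\<integral>x. indicator E x * norm (m x) \<partial>lborel) \<le> C * (\<integral>x. indicator E x powr r \<partial>lborel) powr (1 / r)"
      by (rule weighted_integral_le_if_dual_bound[where B = 1 and R = "real R"])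
         (use C r dual in \<open>auto simp: E_def indicator_def\<close>)
    also have "\<dots> = (\<integral>x. indicator E x * C \<partial>lborel)"
      using True intE by (simp add: mult.commute)
    finally have "(\<integral>x. indicator E x * (norm (m x) - C) \<partial>lborel) \<le> 0"
      using intE intm by (simp add: right_diff_distrib)
    moreover have nonneg: "0 \<le> indicator E x * (norm (m x) - C)" for x
      by (auto simp: E_def indicator_def)
    ultimately have "(\<integral>x. indicator E x * (norm (m x) - C) \<partial>lborel) = 0"
      by (intro antisym integral_nonneg_AE) auto
    moreover have "integrable lborel (\<lambda>x. indicator E x * (norm (m x) - C))"
      using intE intm by (simp add: right_diff_distrib)
    ultimately have "AE x in lborel. indicator E x * (norm (m x) - C) = 0"
      using nonneg by (subst (asm) integral_nonneg_eq_0_iff_AE) auto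
    then show ?thesis by eventually_elim (auto simp: E_def indicator_def split: if_splits)
  qed
  then have "AE x in lborel. \<forall>R::nat. \<not> (norm x < real R \<and> C < norm (m x))"
    unfolding AE_all_countable by blast
  then have "AE x in lborel. norm (m x) \<le> C"
    by eventually_elim (meson not_le reals_Archimedean2)
  then have "AE x in lborel. ennreal (norm (m x)) \<le> ennreal C"
    by eventually_elim (rule ennreal_leI)
  then have "esssup lborel (\<lambda>x. ennreal (norm (m x))) \<le> ennreal C" by (intro esssup_I) auto
  then show ?thesis using True by (simp add: conj_exponent_1 Lp_norm_def)
next
  case False
  then have r1: "r > 1" using r by simp
  \<comment> \<open>The weight will be the truncated power \<open>q - 1\<close> of
    \<open>norm (m x)\<close>. By \<open>(q - 1) * r = q\<close>, both \<open>w x powr r\<close> and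
    \<open>w x * norm (m x)\<close> equal \<open>g R x\<close>, so a single number \<open>J\<close>
    stands on both sides of the weighted inequality.\<close>
  define q where "q = r / (r - 1)"
  have q: "q > 1" "(q - 1) * r = q" "1 - 1 / r = 1 / q"
    using r1 by (auto simp: q_def field_simps)
  define g where "g R x = indicator (ball 0 (real R)) x * norm (m x) powr q" for R :: nat and x
  have [measurable]: "g R \<in> borel_measurable borel" for R
    unfolding g_def by (intro borel_measurable_times borel_measurable_indicator) auto
  have g_nonneg: "0 \<le> g R x" for R x by (simp add: g_def)
  have bound: "(\<integral>\<^sup>+x. ennreal (g R x) \<partial>lborel) \<le> ennreal (C powr q)" for R
  proof -
    define w where "w x = indicator (ball 0 (real R)) x * norm (m x) powr (q - 1)" for x
    have [measurable]: "w \<in> borel_measurable borel" 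
      unfolding w_def by (intro borel_measurable_times borel_measurable_indicator) auto
    have wr: "w x powr r = g R x" for x
      using q by (auto simp: w_def g_def indicator_def powr_powr)
    have wm: "w x * norm (m x) = g R x" for x
    proof -
      have "norm (m x) powr (q - 1) * norm (m x) = norm (m x) powr (q - 1) * norm (m x) powr 1" by simp
      also have "\<dots> = norm (m x) powr q" by (simp only: powr_add[symmetric]) simp
      finally show ?thesis by (simp add: w_def g_def)
    qed
    \<comment> \<open>The ball and the bound \<open>K\<close> make \<open>J\<close> a genuine
      integral and not the default value 0, so that cancelling \<open>J powr (1 / r)\<close> is
      meaningful.\<close>
    have gint: "integrable lborel (g R)"
    proof (rule Bochner_Integration.integrable_bound)
      show "integrable lborel (\<lambda>x. K powr q * indicator (ball 0 (real R) :: 'a set) x)"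
        using emeasure_lborel_ball_finite[of "0::'a" "real R"]
        by (intro integrable_mult_right integrable_real_indicator) auto
    qed (use K q in \<open>auto simp: g_def indicator_def intro!: powr_mono2\<close>)
    define J where "J = (\<integral>x. g R x \<partial>lborel)"
    have J0: "J \<ge> 0" unfolding J_def by (intro integral_nonneg_AE) (auto simp: g_def)
    have "(\<integral>x. w x * norm (m x) \<partial>lborel) \<le> C * (\<integral>x. w x powr r \<partial>lborel) powr (1 / r)"
      by (rule weighted_integral_le_if_dual_bound[where B = "K powr (q - 1)" and R = "real R"])
         (use C r dual K q in \<open>auto simp: w_def indicator_def intro!: powr_mono2\<close>)
    then have JC: "J \<le> C * J powr (1 / r)" by (simp only: wr wm J_def)
    have "J \<le> C powr q"
    proof (cases "J = 0")
      case False
      then have J: "J > 0" using J0 by simp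
      have "J powr (1 / q) = J / J powr (1 / r)" using J by (simp add: q(3)[symmetric] powr_diff)
      also have "\<dots> \<le> C" using JC J by (simp add: pos_divide_le_eq)
      finally have "(J powr (1 / q)) powr q \<le> C powr q" using q by (intro powr_mono2) auto
      then show ?thesis using J q by (simp add: powr_powr)
    qed simp
    then show ?thesis
      unfolding J_def using gint
      by (subst nn_integral_eq_integral) (auto intro!: ennreal_leI simp: g_nonneg)
  qed
  \<comment> \<open>The truncated bound does not depend on \<open>R\<close>, so monotone convergence
    removes the truncation.\<close>
  have "(\<integral>\<^sup>+x. ennreal (norm (m x) powr q) \<partial>lborel) = (\<integral>\<^sup>+x. (SUP R. ennreal (g R x)) \<partial>lborel)"
  proof (intro nn_integral_cong antisym)
    fix x :: 'a
    obtain R :: nat where "norm x < real R" using reals_Archimedean2 by blast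
    then have "norm (m x) powr q = g R x" by (simp add: g_def)
    then show "ennreal (norm (m x) powr q) \<le> (SUP R. ennreal (g R x))" by (auto intro: SUP_upper)
    show "(SUP R. ennreal (g R x)) \<le> ennreal (norm (m x) powr q)"
      by (intro SUP_least ennreal_leI) (auto simp: g_def indicator_def)
  qed
  also have "\<dots> = (SUP R. \<integral>\<^sup>+x. ennreal (g R x) \<partial>lborel)"
    by (intro nn_integral_monotone_convergence_SUP)
       (auto simp: incseq_def le_fun_def g_def indicator_def intro!: ennreal_leI)
  also have "\<dots> \<le> ennreal (C powr q)" by (intro SUP_least bound)
  finally have "Lp_norm (ennreal q) m \<le> ennreal C" using q C by (subst Lp_norm_ennreal_le_iff) auto
  then show ?thesis using r1 by (simp add: conj_exponent_ennreal q_def)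
qed

theorem proposition2:
  fixes p :: ennreal and \<mu> :: "(real ^ 'n) set \<Rightarrow> complex"
  assumes "1 \<le> p" and "p \<le> 2"
    and "finite_complex_measure \<mu>"
    and "star_norm p \<mu> < \<infinity>"
  shows "fourier_measure \<mu> \<in> Lp (conj_exponent p) \<and>
         Lp_norm (conj_exponent p) (fourier_measure \<mu>) \<le> star_norm p \<mu>"
proof -
  \<comment> \<open>\<open>p \<le> 2\<close> makes the exponent a finite real number, as the power
    integrals require.\<close>
  obtain r where p: "p = ennreal r" and "r \<ge> 0"
    using assms(2) by (cases p) (auto simp: top_unique)
  then have r: "r \<ge> 1" using assms(1) by (metis ennreal_1 ennreal_le_iff)
  obtain C where C: "star_norm p \<mu> = ennreal C" "C \<ge> 0"
    using assms(4) by (cases "star_norm p \<mu>") auto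
  have meas: "fourier_measure \<mu> \<in> borel_measurable borel"
    by (intro borel_measurable_continuous_onI continuous_on_fourier_measure assms(3))
  obtain K where K: "\<And>y. norm (fourier_measure \<mu> y) \<le> K" using fourier_measure_bounded by blast
  have "Lp_norm (conj_exponent p) (fourier_measure \<mu>) \<le> star_norm p \<mu>"
    unfolding C(1) unfolding p
  proof (rule Lp_norm_conj_exponent_le_if_dual_bound[OF meas K C(2) r])
    fix u :: "real ^ 'n \<Rightarrow> complex"
    assume u: "integrable lborel u" "(\<integral>\<^sup>+x. ennreal (norm (u x) powr r) \<partial>lborel) \<le> 1"
    show "norm (\<integral>x. u x * fourier_measure \<mu> x \<partial>lborel) \<le> C"
      unfolding integral_mult_fourier_measure[OF assms(3) u(1)]
      using C p by (intro norm_cm_integral_fourier_integral_le[OF assms(3) _ C(2) u r]) simp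
  qed
  then show ?thesis using meas assms(4) by (auto simp: Lp_def)
qed

end
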